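(* Let $A$ be a commutative ring and let $G$ be a commutative group. The following conditions are equivalent: (1) $A[G]$ is a semi-local ring. (2) Both of the following hold: (a) $A$ is a semi-local ring, with radical denoted by $R$; (b) either $G$ is finite, or $G$ is infinite and there is a prime number $p$ such that $A/R$ is a ring of characteristic $p$ and $G = G_p \times G_0$, where $G_p$ is an infinite $p$-group and $G_0$ is a finite group whose order is not divisible by $p$.
   Context: Rings have an identity $1 \neq 0$. $A[G]$ denotes the group ring of $G$ with coefficients in $A$. The radical of a ring is its Jacobson radical. A commutative ring is semi-local if it has only finitely many maximal ideals (no Noetherian hypothesis is imposed); equivalently, its quotient by its Jacobson radical is semisimple Artinian. For a prime $p$, a $p$-group is a group (possibly infinite) in which every element has finite order equal to a power of $p$. The equality $G = G_p \times G_0$ means that $G$ is the internal direct product of subgroups $G_p$ and $G_0$. *)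

theory Defs
  imports
    "HOL-Algebra.Algebra"
begin

text \<open>
  The convolution product sums over the support of the left factor only, because
  \<^const>\<open>finsum\<close> over an infinite index set is \<open>\<zero>\<close> by convention. Elements
  are extensional functions on \<open>carrier G\<close>, so that equality of functions is equality
  in the group ring.
\<close>

definition group_ring :: "('a, 'm) ring_scheme \<Rightarrow> ('g, 'n) monoid_scheme \<Rightarrow> ('g \<Rightarrow> 'a) ring"
  where "group_ring A G =
    \<lparr> carrier = {f \<in> carrier G \<rightarrow>\<^sub>E carrier A. finite {x \<in> carrier G. f x \<noteq> \<zero>\<^bsub>A\<^esub>}},
      monoid.mult = (\<lambda>f g. \<lambda>x\<in>carrier G.
        \<Oplus>\<^bsub>A\<^esub>y\<in>{y \<in> carrier G. f y \<noteq> \<zero>\<^bsub>A\<^esub>}. f y \<otimes>\<^bsub>A\<^esub> g (inv\<^bsub>G\<^esub> y \<otimes>\<^bsub>G\<^esub> x)),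
      one = (\<lambda>x\<in>carrier G. if x = \<one>\<^bsub>G\<^esub> then \<one>\<^bsub>A\<^esub> else \<zero>\<^bsub>A\<^esub>),
      ring.zero = (\<lambda>x\<in>carrier G. \<zero>\<^bsub>A\<^esub>),
      add = (\<lambda>f g. \<lambda>x\<in>carrier G. f x \<oplus>\<^bsub>A\<^esub> g x) \<rparr>"

definition semilocal_ring :: "('a, 'm) ring_scheme \<Rightarrow> bool"
  where "semilocal_ring R \<longleftrightarrow> cring R \<and> \<one>\<^bsub>R\<^esub> \<noteq> \<zero>\<^bsub>R\<^esub> \<and> finite {M. maximalideal M R}"

definition jacobson_radical :: "('a, 'm) ring_scheme \<Rightarrow> 'a set"
  where "jacobson_radical R = {x \<in> carrier R. \<forall>M. maximalideal M R \<longrightarrow> x \<in> M}"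

text \<open>
  The additive order of \<open>\<one>\<close>; \<^const>\<open>group.ord\<close> is \<open>0\<close> for elements of infinite order,
  in agreement with the usual convention for characteristic \<open>0\<close>.
\<close>

definition ring_characteristic :: "('a, 'm) ring_scheme \<Rightarrow> nat"
  where "ring_characteristic R = group.ord (add_monoid R) \<one>\<^bsub>R\<^esub>"

definition p_group :: "nat \<Rightarrow> ('g, 'n) monoid_scheme \<Rightarrow> bool"
  where "p_group p G \<longleftrightarrow> group G \<and> (\<forall>x\<in>carrier G. \<exists>k. group.ord G x = p ^ k)"

definition internal_direct_product :: "('g, 'n) monoid_scheme \<Rightarrow> 'g set \<Rightarrow> 'g set \<Rightarrow> bool"
  where "internal_direct_product G H K \<longleftrightarrow>
    H \<lhd> G \<and> K \<lhd> G \<and> H \<inter> K = {\<one>\<^bsub>G\<^esub>} \<and> H <#>\<^bsub>G\<^esub> K = carrier G"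

end

theory Submission
  imports Defs
begin

text \<open>
  Write \<open>S = A[G]\<close>, with \<open>A\<close> embedded as the constants and \<open>G\<close> as the elements
  \<open>elt g\<close>.

  Suppose that \<open>A\<close> is semi-local and \<open>G\<close> is torsion. An element of \<open>S\<close> lies in
  \<open>A[H]\<close> for a finite subgroup \<open>H\<close>, hence is integral over \<open>A\<close>; so a maximal ideal of \<open>S\<close>
  contracts to a maximal ideal of \<open>A\<close> (\<open>maximalideal_contraction\<close>), and only the fibres of this
  contraction have to be bounded. If a finite set \<open>Y \<subseteq> G\<close> represents every element of \<open>G\<close> modulo
  every maximal ideal of \<open>S\<close>, then modulo the intersection of the maximal ideals over \<open>m\<close> the ring
  \<open>S\<close> is a vector space over \<open>A/m\<close> spanned by \<open>Y\<close>, so this fibre is finite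
  (\<open>finite_maximalideals_over\<close>, \<open>semilocal_group_ringI\<close>). For a finite \<open>G\<close>, take
  \<open>Y = G\<close>. For \<open>G = G\<^sub>p \<times> G\<^sub>0\<close> and a radical containing \<open>p\<close>, take \<open>Y = G\<^sub>0\<close>: every residue
  field of \<open>S\<close> has characteristic \<open>p\<close>, and an element of \<open>p\<close>-power order in such a field is \<open>1\<close>
  (\<open>maximalideal_frobenius\<close>).

  Conversely, suppose that \<open>S\<close> is semi-local. Every maximal ideal \<open>m\<close> of \<open>A\<close> is the contraction
  of one of \<open>S\<close>, because \<open>mS \<noteq> S\<close>; so \<open>A\<close> is semi-local. Then infinite families of maximal
  ideals are constructed in \<open>S\<close> from two kinds of subgroups of \<open>G\<close>.

  If \<open>x\<close> has infinite order, the elements \<open>1 + x + \<dots> + x\<^sup>q\<^sup>-\<^sup>1\<close> for prime \<open>q\<close> are non-units that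
  are pairwise comaximal (\<open>geometric_sum_nonunit\<close>, \<open>geometric_sum_coprime\<close>). Hence \<open>G\<close> is torsion.

  Let \<open>c\<close> be the characteristic of \<open>A/m\<close>. If infinitely many elements of \<open>G\<close> had order not
  divisible by \<open>c\<close>, there would be a chain \<open>F\<^sub>0 \<subset> F\<^sub>1 \<subset> \<dots>\<close> of finite subgroups whose orders are
  invertible in \<open>A/m\<close>. Over \<open>A/m\<close>, the averages \<open>e\<^sub>i\<close> of the \<open>F\<^sub>i\<close> are idempotents with
  \<open>e\<^sub>i e\<^sub>j = e\<^sub>j\<close> for \<open>i \<le> j\<close>, and the differences of successive ones are non-zero orthogonal
  idempotents, each of which is avoided by some maximal ideal that contains all the others. Multiples of
  these differences lift to \<open>S\<close> and give the contradiction (\<open>subgroup_diff_orthogonal\<close>,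
  \<open>subgroup_diff_notin_maximalideal\<close>). So the elements of order not divisible by \<open>c\<close> are finite in
  number (\<open>finite_prime_to_characteristic\<close>). If \<open>G\<close> is infinite, this forces \<open>c\<close> to be a prime;
  and two different characteristics for different \<open>m\<close> would force \<open>G\<close> to be finite, since every element of \<open>G\<close>
  is a product of one of \<open>p\<close>-power order and one of order prime to \<open>p\<close>. Thus a single prime \<open>p\<close>
  occurs, \<open>A/R\<close> has characteristic \<open>p\<close>, and \<open>G\<close> is the product of its \<open>p\<close>-part and its
  finite part prime to \<open>p\<close> (\<open>semilocal_imp_p_group_by_finite\<close>).
\<close>

section \<open>Maximal ideals of commutative rings\<close>

text \<open>
  Zorn's lemma is available because the union of a non-empty chain of ideals avoiding \<open>\<one>\<close> is again such
  an ideal.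
\<close>

lemma (in cring) ideal_subset_maximalideal:
  assumes "ideal I R" "\<one> \<notin> I"
  shows "\<exists>M. maximalideal M R \<and> I \<subseteq> M"
proof -
  define S where "S = {J. ideal J R \<and> \<one> \<notin> J \<and> I \<subseteq> J}"
  have "\<exists>M\<in>S. \<forall>J\<in>S. M \<subseteq> J \<longrightarrow> J = M"
  proof (rule subset_Zorn)
    fix C assume C: "subset.chain S C"
    show "\<exists>U\<in>S. \<forall>J\<in>C. J \<subseteq> U"
    proof (cases "C = {}")
      case True
      then show ?thesis using assms by (auto simp: S_def)
    next
      case False
      have "subset.chain {I. ideal I R} C"
        using C unfolding pred_on.chain_def S_def by auto
      then have UC: "ideal (\<Union>C) R"
        using chain_Union_is_ideal[of C] False by simp
      have C': "\<one> \<notin> J \<and> I \<subseteq> J" if "J \<in> C" for J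
        using C that unfolding pred_on.chain_def S_def by auto
      then have "\<one> \<notin> \<Union>C" "I \<subseteq> \<Union>C" using False by blast+
      with UC have "\<Union>C \<in> S" unfolding S_def by blast
      then show ?thesis by blast
    qed
  qed
  then obtain M where M: "M \<in> S" "\<And>J. J \<in> S \<Longrightarrow> M \<subseteq> J \<Longrightarrow> J = M" by blast
  have "maximalideal M R"
  proof (rule maximalidealI)
    show "ideal M R" "carrier R \<noteq> M" using M(1) by (auto simp: S_def)
    show "J = M \<or> J = carrier R" if J: "ideal J R" "M \<subseteq> J" "J \<subseteq> carrier R" for J
    proof (cases "\<one> \<in> J")
      case True
      then show ?thesis using ideal.one_imp_carrier[OF J(1)] by blast
    next
      case False
      then have "J \<in> S" using J M(1) unfolding S_def by blast
      then show ?thesis using M(2) J(2) by blast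
    qed
  qed
  then show ?thesis using M(1) by (auto simp: S_def)
qed

lemma (in cring) nonunit_in_maximalideal:
  assumes "x \<in> carrier R" "x \<notin> Units R"
  shows "\<exists>M. maximalideal M R \<and> x \<in> M"
proof -
  have "\<one> \<notin> PIdl x"
    using assms by (force simp: cgenideal_def Units_def m_comm)
  then show ?thesis
    using ideal_subset_maximalideal[OF cgenideal_ideal] cgenideal_self assms by blast
qed

context cring begin

lemma maximalideal_ideal: "maximalideal M R \<Longrightarrow> ideal M R"
  by (simp add: maximalideal.axioms(1))

lemma ideal_closed:
  assumes "ideal I R"
  shows "x \<in> I \<Longrightarrow> x \<in> carrier R" "\<zero> \<in> I"
    "x \<in> I \<Longrightarrow> y \<in> I \<Longrightarrow> x \<oplus> y \<in> I"
    "x \<in> I \<Longrightarrow> \<ominus> x \<in> I" "x \<in> I \<Longrightarrow> y \<in> I \<Longrightarrow> x \<ominus> y \<in> I"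
    "x \<in> I \<Longrightarrow> r \<in> carrier R \<Longrightarrow> r \<otimes> x \<in> I"
    "x \<in> I \<Longrightarrow> r \<in> carrier R \<Longrightarrow> x \<otimes> r \<in> I"
proof -
  interpret I: ideal I R by fact
  show "x \<in> I \<Longrightarrow> x \<in> carrier R" "\<zero> \<in> I"
    "x \<in> I \<Longrightarrow> y \<in> I \<Longrightarrow> x \<oplus> y \<in> I"
    "x \<in> I \<Longrightarrow> \<ominus> x \<in> I" "x \<in> I \<Longrightarrow> y \<in> I \<Longrightarrow> x \<ominus> y \<in> I"
    "x \<in> I \<Longrightarrow> r \<in> carrier R \<Longrightarrow> r \<otimes> x \<in> I"
    "x \<in> I \<Longrightarrow> r \<in> carrier R \<Longrightarrow> x \<otimes> r \<in> I"
    by (auto simp: I.I_l_closed I.I_r_closed a_minus_def)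
qed

lemma one_notin_maximalideal: "maximalideal M R \<Longrightarrow> \<one> \<notin> M"
  using ideal.one_imp_carrier[OF maximalideal_ideal] maximalideal.I_notcarr[of M R] by auto

lemma maximalideal_prod:
  assumes "maximalideal M R" "a \<in> carrier R" "b \<in> carrier R" "a \<otimes> b \<in> M"
  shows "a \<in> M \<or> b \<in> M"
  using primeideal.I_prime[OF maximalideal_prime[OF assms(1)] assms(2-4)] .

lemma maximalideal_eq:
  assumes "maximalideal M R" "ideal I R" "M \<subseteq> I" "\<one> \<notin> I"
  shows "I = M"
  using maximalideal.I_maximal[OF assms(1-3)] assms(4) ideal_closed(1)[OF assms(2)] by auto

lemma inverse_mod_maximalideal:
  assumes "maximalideal M R" "x \<in> carrier R" "x \<notin> M"
  shows "\<exists>y\<in>carrier R. x \<otimes> y \<ominus> \<one> \<in> M"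
proof -
  have M: "ideal M R" using assms maximalideal_ideal by blast
  have I: "ideal (M <+> PIdl x) R"
    using M assms cgenideal_ideal add_ideals by blast
  have "M \<subseteq> M <+> PIdl x"
  proof
    fix m assume m: "m \<in> M"
    moreover have "\<zero> \<in> PIdl x" using ideal_closed(2)[OF cgenideal_ideal] assms by blast
    ultimately show "m \<in> M <+> PIdl x"
      unfolding set_add_def' using ideal_closed(1)[OF M m] by force
  qed
  moreover have "x \<in> M <+> PIdl x"
    unfolding set_add_def' using ideal_closed(2)[OF M] cgenideal_self[of x] assms by force
  ultimately have "\<one> \<in> M <+> PIdl x"
    using maximalideal_eq[OF assms(1) I] assms(3) by blast
  then obtain m y where my: "m \<in> M" "y \<in> carrier R" "\<one> = m \<oplus> y \<otimes> x"
    by (auto simp: set_add_def' cgenideal_def)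
  have "m \<in> carrier R" using my ideal_closed[OF M] by blast
  then have "x \<otimes> y \<ominus> \<one> = \<ominus> m"
    using my assms unfolding my(3) by algebra
  moreover have "\<ominus> m \<in> M" using my(1) ideal_closed(4)[OF M] by blast
  ultimately show ?thesis using my(2) by (intro bexI[of _ y]) simp_all
qed

lemma ideal_nat_multiple:
  assumes "ideal I R" "x \<in> I"
  shows "[(n::nat)] \<cdot> x \<in> I"
  using ideal_closed[OF assms(1)] assms(2) by (induction n) auto

end

context cring begin

lemma ideal_Inter_maximalideals:
  assumes "\<And>N. N \<in> F \<Longrightarrow> maximalideal N R"
  shows "ideal {x \<in> carrier R. \<forall>N\<in>F. x \<in> N} R"
proof -
  note I = ideal_closed[OF maximalideal_ideal[OF assms]]
  show ?thesis
  proof (rule idealI)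
    show "ring R" by (rule ring_axioms)
    show "subgroup {x \<in> carrier R. \<forall>N\<in>F. x \<in> N} (add_monoid R)"
      by (rule add.subgroupI) (use I in \<open>auto simp: a_inv_def[symmetric]\<close>)
  qed (use I in auto)
qed

text \<open>
  For each \<open>M \<in> F\<close> there is an element of \<open>M\<close> outside \<open>N\<close>, since distinct maximal ideals are
  not comparable. The product of these elements stays outside \<open>N\<close> because \<open>N\<close> is prime.
\<close>

lemma maximalideals_avoidance:
  assumes "finite F" "\<And>M. M \<in> F \<Longrightarrow> maximalideal M R" "maximalideal N R" "N \<notin> F"
  shows "\<exists>u\<in>carrier R. (\<forall>M\<in>F. u \<in> M) \<and> u \<notin> N"
  using assms(1,2,4)
proof (induction F)
  case empty
  then show ?case using one_notin_maximalideal[OF assms(3)] by auto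
next
  case (insert M F)
  have M: "maximalideal M R" using insert.prems by blast
  note I = ideal_closed[OF maximalideal_ideal]
  obtain u where u: "u \<in> carrier R" "\<And>M. M \<in> F \<Longrightarrow> u \<in> M" "u \<notin> N"
    using insert by auto
  have "\<not> M \<subseteq> N"
    using maximalideal_eq[OF M maximalideal_ideal[OF assms(3)]] insert.prems
      one_notin_maximalideal[OF assms(3)] by auto
  then obtain v where v: "v \<in> M" "v \<notin> N" by blast
  have vc: "v \<in> carrier R" using I(1)[OF M] v by blast
  have "v \<otimes> u \<notin> N" using maximalideal_prod[OF assms(3) vc u(1)] u v by blast
  moreover have "v \<otimes> u \<in> K" if "K \<in> insert M F" for K
    using that I(6,7)[OF insert.prems(1)[OF that]] u v vc by auto
  ultimately show ?case using u(1) vc by (intro bexI[of _ "v \<otimes> u"]) auto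
qed

end

section \<open>The Frobenius congruence modulo a maximal ideal\<close>

context cring begin

lemma binomial:
  assumes "z \<in> carrier R"
  shows "(\<one> \<oplus> z) [^] (n::nat) = (\<Oplus>i\<in>{..n}. [(n choose i)] \<cdot> (z [^] i))"
proof (induction n)
  case 0
  then show ?case using assms by simp
next
  case (Suc n)
  let ?f = "\<lambda>n i. [(n choose i)] \<cdot> (z [^] i)"
  have z: "z [^] i \<in> carrier R" for i :: nat using assms by simp
  have c: "?f n i \<in> carrier R" for n i using z by simp
  have pascal: "?f (Suc n) (Suc i) = ?f n i \<otimes> z \<oplus> ?f n (Suc i)" for i
    using z assms by (simp add: add_pow_ldistr add.nat_pow_mult)
  have "(\<Oplus>i\<in>{..Suc n}. ?f (Suc n) i) =
      (\<Oplus>i\<in>{..n}. ?f n i \<otimes> z \<oplus> ?f n (Suc i)) \<oplus> ?f n 0"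
    using c by (subst finsum_Suc2) (auto simp only: pascal binomial_n_0)
  also have "\<dots> = (\<Oplus>i\<in>{..n}. ?f n i \<otimes> z) \<oplus> ((\<Oplus>i\<in>{..n}. ?f n (Suc i)) \<oplus> ?f n 0)"
    using c assms by (subst finsum_addf) (auto simp: a_assoc)
  also have "(\<Oplus>i\<in>{..n}. ?f n (Suc i)) \<oplus> ?f n 0 = (\<Oplus>i\<in>{..Suc n}. ?f n i)"
    using c by (subst finsum_Suc2) auto
  also have "\<dots> = (\<Oplus>i\<in>{..n}. ?f n i)"
    using c assms by (subst finsum_Suc) (auto simp: binomial_eq_0)
  also have "(\<Oplus>i\<in>{..n}. ?f n i \<otimes> z) = (\<Oplus>i\<in>{..n}. ?f n i) \<otimes> z"
    using c assms by (subst finsum_ldistr) auto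
  also have "(\<Oplus>i\<in>{..n}. ?f n i) \<otimes> z \<oplus> (\<Oplus>i\<in>{..n}. ?f n i) = (\<one> \<oplus> z) [^] n \<otimes> (\<one> \<oplus> z)"
    using assms by (simp add: Suc.IH[symmetric] r_distr a_comm)
  finally show ?case by simp
qed

lemma finsum_in_ideal:
  assumes "ideal I R" "\<And>i. i \<in> F \<Longrightarrow> f i \<in> I"
  shows "(\<Oplus>i\<in>F. f i) \<in> I"
  using assms(2)
proof (induction F rule: infinite_finite_induct)
  case (insert x F)
  then have "f \<in> insert x F \<rightarrow> carrier R" using ideal_closed(1)[OF assms(1)] by auto
  then show ?case using insert ideal_closed(3)[OF assms(1)] by (simp add: finsum_insert)
qed (use ideal_closed(2)[OF assms(1)] in \<open>auto simp: finsum_infinite\<close>)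

lemma maximalideal_pow:
  assumes "maximalideal M R" "a \<in> carrier R" "a [^] (n::nat) \<in> M"
  shows "a \<in> M"
  using assms(3)
proof (induction n)
  case 0
  then show ?case using one_notin_maximalideal[OF assms(1)] by simp
next
  case (Suc n)
  then show ?case using maximalideal_prod[OF assms(1), of "a [^] n" a] assms(2) by auto
qed

text \<open>
  All inner binomial coefficients of exponent \<open>p\<close> are divisible by \<open>p\<close>, so
  \<open>(\<one> \<oplus> z)\<^sup>p\<close> is congruent to \<open>\<one> \<oplus> z\<^sup>p\<close> modulo \<open>M\<close>. In other words, a field of characteristic
  \<open>p\<close> contains no \<open>p\<close>-th root of unity except \<open>1\<close>.
\<close>

lemma maximalideal_frobenius:
  assumes M: "maximalideal M R" and p: "Factorial_Ring.prime p" "[(p::nat)] \<cdot> \<one> \<in> M"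
    and z: "z \<in> carrier R" and "(\<one> \<oplus> z) [^] p \<ominus> \<one> \<in> M"
  shows "z \<in> M"
proof -
  note I = ideal_closed[OF maximalideal_ideal[OF M]]
  let ?f = "\<lambda>i. [(p choose i)] \<cdot> (z [^] i)"
  have c: "?f i \<in> carrier R" for i using z by simp
  \<comment> \<open>The first and the last term of the binomial sum are split off with \<open>finsum_Suc2\<close>, which needs a
    successor.\<close>
  obtain q where q: "p = Suc q" using prime_gt_0_nat[OF p(1)] by (cases p) auto
  have dvd: "[(p * k)] \<cdot> x \<in> M" if "x \<in> carrier R" for x k
  proof -
    have "[(p * k)] \<cdot> x = [k] \<cdot> (([p] \<cdot> \<one>) \<otimes> x)"
      using that by (simp add: add_pow_ldistr add.nat_pow_pow)
    then show ?thesis using I p(2) that ideal_nat_multiple[OF maximalideal_ideal[OF M]] by simp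
  qed
  have mid: "?f (Suc i) \<in> M" if "i < q" for i
    using dvd_choose_prime[of "Suc i" p] p(1) that q z dvd by (auto elim!: dvdE)
  have S: "(\<Oplus>i\<in>{..<q}. ?f (Suc i)) \<in> M"
    using finsum_in_ideal[OF maximalideal_ideal[OF M], of "{..<q}"] mid by auto
  have sc: "(\<Oplus>i\<in>{..<q}. ?f (Suc i)) \<in> carrier R"
    using c by (intro finsum_closed) blast
  have "(\<one> \<oplus> z) [^] p = (\<Oplus>i\<in>{..q}. ?f (Suc i)) \<oplus> \<one>"
    unfolding binomial[OF z] using c by (subst q, subst finsum_Suc2) (auto simp: q[symmetric])
  also have "(\<Oplus>i\<in>{..q}. ?f (Suc i)) = z [^] p \<oplus> (\<Oplus>i\<in>{..<q}. ?f (Suc i))"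
  proof -
    have "{..q} = insert q {..<q}" by auto
    then have "(\<Oplus>i\<in>{..q}. ?f (Suc i)) = ?f (Suc q) \<oplus> (\<Oplus>i\<in>{..<q}. ?f (Suc i))"
      by (simp only:) (rule finsum_insert; use z in auto)
    then show ?thesis using q z by simp
  qed
  finally have expand: "(\<one> \<oplus> z) [^] p = z [^] p \<oplus> (\<Oplus>i\<in>{..<q}. ?f (Suc i)) \<oplus> \<one>" .
  have "a = (a \<oplus> b \<oplus> \<one>) \<ominus> \<one> \<ominus> b" if "a \<in> carrier R" "b \<in> carrier R" for a b
    using that by algebra
  from this[OF nat_pow_closed[OF z] sc]
  have "z [^] p = ((\<one> \<oplus> z) [^] p \<ominus> \<one>) \<ominus> (\<Oplus>i\<in>{..<q}. ?f (Suc i))"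
    unfolding expand .
  then have "z [^] p \<in> M" using I(5) S assms(5) by auto
  then show ?thesis using maximalideal_pow M z by blast
qed

end

section \<open>Geometric sums\<close>

text \<open>
  The sum \<open>1 + x + \<dots> + x\<^sup>n\<^sup>-\<^sup>1\<close>, in Horner form so that no finite sum over an index set is involved.
\<close>

primrec geometric_sum :: "('a, 'm) ring_scheme \<Rightarrow> 'a \<Rightarrow> nat \<Rightarrow> 'a" where
  "geometric_sum R x 0 = \<zero>\<^bsub>R\<^esub>"
| "geometric_sum R x (Suc n) = \<one>\<^bsub>R\<^esub> \<oplus>\<^bsub>R\<^esub> x \<otimes>\<^bsub>R\<^esub> geometric_sum R x n"

context cring begin

lemma geometric_sum_closed [simp]: "x \<in> carrier R \<Longrightarrow> geometric_sum R x n \<in> carrier R"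
  by (induction n) auto

lemma geometric_sum_telescope:
  assumes x: "x \<in> carrier R"
  shows "(x \<ominus> \<one>) \<otimes> geometric_sum R x n = x [^] n \<ominus> \<one>"
proof (induction n)
  case 0
  then show ?case using assms by (simp add: a_minus_def r_neg)
next
  case (Suc n)
  have g: "geometric_sum R x n \<in> carrier R" and y: "x [^] n \<in> carrier R" using x by auto
  have "(x \<ominus> \<one>) \<otimes> geometric_sum R x (Suc n) = (x \<ominus> \<one>) \<oplus> x \<otimes> ((x \<ominus> \<one>) \<otimes> geometric_sum R x n)"
    using x g unfolding geometric_sum.simps by algebra
  also have "\<dots> = (x \<ominus> \<one>) \<oplus> x \<otimes> (x [^] n \<ominus> \<one>)" by (simp only: Suc.IH)
  also have "\<dots> = x [^] n \<otimes> x \<ominus> \<one>" using x y by algebra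
  finally show ?case by simp
qed

lemma geometric_sum_add:
  assumes x: "x \<in> carrier R"
  shows "geometric_sum R x (m + n) = geometric_sum R x m \<oplus> x [^] m \<otimes> geometric_sum R x n"
proof (induction m)
  case (Suc m)
  have g: "geometric_sum R x n \<in> carrier R" "geometric_sum R x m \<in> carrier R"
    and y: "x [^] m \<in> carrier R" using x by auto
  have "\<one> \<oplus> x \<otimes> (geometric_sum R x m \<oplus> x [^] m \<otimes> geometric_sum R x n) =
      \<one> \<oplus> x \<otimes> geometric_sum R x m \<oplus> x [^] m \<otimes> x \<otimes> geometric_sum R x n"
    using x g y by algebra
  then show ?case by (simp add: Suc.IH)
qed (use x in simp)

lemma geometric_sum_multiple:
  assumes x: "x \<in> carrier R" and I: "ideal I R" "geometric_sum R x m \<in> I"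
  shows "geometric_sum R x (m * k) \<in> I"
  using ideal_closed[OF I(1)] I(2) x
  by (induction k) (auto simp: geometric_sum_add)

text \<open>
  A Bezout relation \<open>m a = n b + 1\<close> expresses \<open>\<one>\<close> through the sums of length \<open>m a\<close> and
  \<open>n b\<close>, which are multiples of those of length \<open>m\<close> and \<open>n\<close>.
\<close>

lemma geometric_sum_coprime:
  assumes x: "x \<in> carrier R" and I: "ideal I R" "geometric_sum R x m \<in> I" "geometric_sum R x n \<in> I"
    and "coprime m n" "m \<noteq> 0"
  shows "\<one> \<in> I"
proof -
  obtain a b where ab: "m * a = n * b + 1"
    using bezout_nat[of m n] assms by auto
  let ?g = "geometric_sum R x"
  have m: "?g (m * a) \<in> I" and n: "?g (n * b) \<in> I" 
    using geometric_sum_multiple assms by blast+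
  have "?g (m * a) = \<one> \<oplus> x \<otimes> ?g (n * b)" unfolding ab by simp
  then have "?g (m * a) \<ominus> x \<otimes> ?g (n * b) = \<one>"
    using x by (simp add: a_minus_def a_assoc r_neg)
  then show ?thesis using ideal_closed[OF I(1)] m n x by metis
qed

end

section \<open>Contraction of maximal ideals along integral homomorphisms\<close>

text \<open>
  The set \<open>J + h(C) e\<^sub>1 + \<dots> + h(C) e\<^sub>n\<close>. The recursion on the list of generators permits elimination
  of one generator at a time without any manipulation of sums. The coefficients \<open>C\<close> are all of
  the base ring or one of its maximal ideals.
\<close>

primrec mod_span :: "('b, 'n) ring_scheme \<Rightarrow> ('a \<Rightarrow> 'b) \<Rightarrow> 'a set \<Rightarrow> 'b set \<Rightarrow> 'b list \<Rightarrow> 'b set" where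
  "mod_span S h C J [] = J"
| "mod_span S h C J (e # es) =
    {w \<oplus>\<^bsub>S\<^esub> h a \<otimes>\<^bsub>S\<^esub> e | w a. w \<in> mod_span S h C J es \<and> a \<in> C}"

context ring_hom_cring begin

lemma mod_span_subset:
  assumes "ideal J S" "C \<subseteq> carrier R" "set es \<subseteq> carrier S"
  shows "mod_span S h C J es \<subseteq> carrier S"
  using assms(3) by (induction es) (use assms S.ideal_closed(1) in \<open>auto 0 4\<close>)

lemma mod_span_base:
  assumes "ideal J S" "ideal C R" "set es \<subseteq> carrier S" "x \<in> J"
  shows "x \<in> mod_span S h C J es"
  using assms(3)
proof (induction es)
  case (Cons e es)
  have "x = x \<oplus>\<^bsub>S\<^esub> h \<zero> \<otimes>\<^bsub>S\<^esub> e"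
    using Cons.prems S.ideal_closed(1)[OF assms(1,4)] by simp
  moreover have "x \<in> mod_span S h C J es" using Cons by simp
  ultimately show ?case unfolding mod_span.simps using R.ideal_closed(2)[OF assms(2)] by blast
qed (use assms in simp)

lemma mod_span_add:
  assumes J: "ideal J S" and C: "ideal C R" and "set es \<subseteq> carrier S"
    and "x \<in> mod_span S h C J es" "y \<in> mod_span S h C J es"
  shows "x \<oplus>\<^bsub>S\<^esub> y \<in> mod_span S h C J es"
  using assms(3-)
proof (induction es arbitrary: x y)
  case Nil
  then show ?case using S.ideal_closed[OF J] by simp
next
  case (Cons e es)
  have Cc: "C \<subseteq> carrier R" using R.ideal_closed(1)[OF C] by blast
  have sub: "mod_span S h C J es \<subseteq> carrier S" using mod_span_subset J Cc Cons.prems by auto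
  obtain v a w b where x: "x = v \<oplus>\<^bsub>S\<^esub> h a \<otimes>\<^bsub>S\<^esub> e" "v \<in> mod_span S h C J es" "a \<in> C"
    and y: "y = w \<oplus>\<^bsub>S\<^esub> h b \<otimes>\<^bsub>S\<^esub> e" "w \<in> mod_span S h C J es" "b \<in> C"
    using Cons.prems by auto
  have c: "v \<in> carrier S" "w \<in> carrier S" "h a \<in> carrier S" "h b \<in> carrier S" "e \<in> carrier S"
    "a \<in> carrier R" "b \<in> carrier R"
    using x y sub Cc Cons.prems by auto
  have "x \<oplus>\<^bsub>S\<^esub> y = (v \<oplus>\<^bsub>S\<^esub> w) \<oplus>\<^bsub>S\<^esub> (h a \<oplus>\<^bsub>S\<^esub> h b) \<otimes>\<^bsub>S\<^esub> e"
    unfolding x(1) y(1) using c(1-5) by algebra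
  also have "h a \<oplus>\<^bsub>S\<^esub> h b = h (a \<oplus> b)" using c by simp
  finally show ?case
    using Cons.IH[of v w] Cons.prems x y R.ideal_closed(3)[OF C x(3) y(3)] by auto
qed

text \<open>
  Two sets of coefficients occur because multiplication by an element of an ideal \<open>D\<close> turns arbitrary
  coefficients into coefficients in \<open>D\<close>.
\<close>

lemma mod_span_smult:
  assumes J: "ideal J S" and C: "C \<subseteq> carrier R" and "set es \<subseteq> carrier S"
    and r: "r \<in> carrier R" and CD: "\<And>a. a \<in> C \<Longrightarrow> r \<otimes> a \<in> D" and "x \<in> mod_span S h C J es"
  shows "h r \<otimes>\<^bsub>S\<^esub> x \<in> mod_span S h D J es"
  using assms(3,6)
proof (induction es arbitrary: x)
  case Nil
  then show ?case using S.ideal_closed[OF J] r by simp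
next
  case (Cons e es)
  have sub: "mod_span S h C J es \<subseteq> carrier S" using mod_span_subset J C Cons.prems by auto
  obtain v a where x: "x = v \<oplus>\<^bsub>S\<^esub> h a \<otimes>\<^bsub>S\<^esub> e" "v \<in> mod_span S h C J es" "a \<in> C"
    using Cons.prems by auto
  have c: "v \<in> carrier S" "h a \<in> carrier S" "h r \<in> carrier S" "e \<in> carrier S" "a \<in> carrier R"
    using x sub C Cons.prems r by auto
  have "h r \<otimes>\<^bsub>S\<^esub> x = h r \<otimes>\<^bsub>S\<^esub> v \<oplus>\<^bsub>S\<^esub> (h r \<otimes>\<^bsub>S\<^esub> h a) \<otimes>\<^bsub>S\<^esub> e"
    unfolding x(1) using c(1-4) by algebra
  also have "h r \<otimes>\<^bsub>S\<^esub> h a = h (r \<otimes> a)" using c r by simp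
  finally show ?case using Cons.IH[of v] Cons.prems x CD[OF x(3)] by auto
qed

lemma mod_span_minus:
  assumes J: "ideal J S" and C: "ideal C R" and "set es \<subseteq> carrier S"
    and "x \<in> mod_span S h C J es" "y \<in> mod_span S h C J es"
  shows "x \<ominus>\<^bsub>S\<^esub> y \<in> mod_span S h C J es"
proof -
  have Cc: "C \<subseteq> carrier R" using R.ideal_closed(1)[OF C] by blast
  have y: "y \<in> carrier S" using mod_span_subset[OF J Cc] assms by blast
  have "h (\<ominus> \<one>) \<otimes>\<^bsub>S\<^esub> y \<in> mod_span S h C J es"
    using mod_span_smult[OF J Cc assms(3) _ _ assms(5), of "\<ominus> \<one>" C] R.ideal_closed(6)[OF C] by simp
  moreover have "h (\<ominus> \<one>) \<otimes>\<^bsub>S\<^esub> y = \<ominus>\<^bsub>S\<^esub> y" using y by (simp add: S.l_minus)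
  ultimately show ?thesis using mod_span_add[OF J C assms(3,4)] by (simp add: a_minus_def)
qed

lemma mod_span_generator:
  assumes J: "ideal J S" and "set es \<subseteq> carrier S" "e \<in> set es"
  shows "e \<in> mod_span S h (carrier R) J es"
  using assms(2,3)
proof (induction es)
  case (Cons e' es)
  have c: "e \<in> carrier S" "e' \<in> carrier S" "set es \<subseteq> carrier S" using Cons.prems by auto
  show ?case
  proof (cases "e = e'")
    case True
    have "\<zero>\<^bsub>S\<^esub> \<in> mod_span S h (carrier R) J es"
      using mod_span_base[OF J R.oneideal c(3)] S.ideal_closed(2)[OF J] by blast
    moreover have "e = \<zero>\<^bsub>S\<^esub> \<oplus>\<^bsub>S\<^esub> h \<one> \<otimes>\<^bsub>S\<^esub> e'" using c True by simp
    ultimately show ?thesis unfolding mod_span.simps by blast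
  next
    case False
    then have "e \<in> mod_span S h (carrier R) J es" using Cons by simp
    moreover have "e = e \<oplus>\<^bsub>S\<^esub> h \<zero> \<otimes>\<^bsub>S\<^esub> e'" using c by simp
    ultimately show ?thesis unfolding mod_span.simps by blast
  qed
qed simp

text \<open>
  This is Nakayama's lemma for the module generated by \<open>es\<close> over the localization at \<open>m\<close>, with
  denominators cleared. From \<open>b e = v + \<mu> e\<close> with \<open>\<mu> \<in> m\<close> it follows that \<open>(b - \<mu>) e = v\<close>
  does not involve \<open>e\<close> any more; so multiplication by \<open>b - \<mu>\<close>, which is still outside \<open>m\<close>, removes
  the generator \<open>e\<close> from all relations.
\<close>

lemma nakayama_descent:
  assumes m: "maximalideal m R" and J: "ideal J S" and Y: "Y \<subseteq> carrier S"
    and "set es \<subseteq> Y" and "b \<in> carrier R - m" "\<And>x. x \<in> Y \<Longrightarrow> h b \<otimes>\<^bsub>S\<^esub> x \<in> mod_span S h m J es"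
  shows "\<exists>c\<in>carrier R - m. \<forall>x\<in>Y. h c \<otimes>\<^bsub>S\<^esub> x \<in> J"
  using assms(4-)
proof (induction es arbitrary: b)
  case Nil
  then show ?case by auto
next
  case (Cons e es)
  note mi = R.maximalideal_ideal[OF m]
  have mc: "m \<subseteq> carrier R" using R.ideal_closed(1)[OF mi] by blast
  have es: "set es \<subseteq> carrier S" and e: "e \<in> carrier S" using Cons.prems Y by auto
  have sub: "mod_span S h m J es \<subseteq> carrier S" using mod_span_subset[OF J mc es] .
  obtain v \<mu> where v: "h b \<otimes>\<^bsub>S\<^esub> e = v \<oplus>\<^bsub>S\<^esub> h \<mu> \<otimes>\<^bsub>S\<^esub> e" "v \<in> mod_span S h m J es" "\<mu> \<in> m"
    using Cons.prems(3)[of e] Cons.prems(1) by auto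
  have c: "v \<in> carrier S" "\<mu> \<in> carrier R" "b \<in> carrier R" "h b \<in> carrier S" "h \<mu> \<in> carrier S"
    using v sub mc Cons.prems by auto
  let ?c = "b \<ominus> \<mu>"
  have cc: "?c \<in> carrier R" using c by simp
  have hc: "h ?c = h b \<ominus>\<^bsub>S\<^esub> h \<mu>" using c by (simp add: a_minus_def)
  have "b = ?c \<oplus> \<mu>" using c(2,3) by algebra
  then have cm: "?c \<notin> m" using Cons.prems(2) v(3) R.ideal_closed(3)[OF mi, of ?c \<mu>] by auto
  have "h ?c \<otimes>\<^bsub>S\<^esub> e = h b \<otimes>\<^bsub>S\<^esub> e \<ominus>\<^bsub>S\<^esub> h \<mu> \<otimes>\<^bsub>S\<^esub> e" unfolding hc using c e by algebra
  also have "\<dots> = v" unfolding v(1) using c e by algebra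
  finally have ce: "h ?c \<otimes>\<^bsub>S\<^esub> e = v" .
  have "h (?c \<otimes> b) \<otimes>\<^bsub>S\<^esub> x \<in> mod_span S h m J es" if x: "x \<in> Y" for x
  proof -
    obtain w \<nu> where w: "h b \<otimes>\<^bsub>S\<^esub> x = w \<oplus>\<^bsub>S\<^esub> h \<nu> \<otimes>\<^bsub>S\<^esub> e" "w \<in> mod_span S h m J es" "\<nu> \<in> m"
      using Cons.prems(3)[OF x] by auto
    have d: "w \<in> carrier S" "\<nu> \<in> carrier R" "h \<nu> \<in> carrier S" "x \<in> carrier S" "h ?c \<in> carrier S"
      using w sub mc x Y cc by auto
    have "h (?c \<otimes> b) \<otimes>\<^bsub>S\<^esub> x = h ?c \<otimes>\<^bsub>S\<^esub> (h b \<otimes>\<^bsub>S\<^esub> x)" using c d cc by (simp add: S.m_assoc)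
    also have "\<dots> = h ?c \<otimes>\<^bsub>S\<^esub> w \<oplus>\<^bsub>S\<^esub> h \<nu> \<otimes>\<^bsub>S\<^esub> (h ?c \<otimes>\<^bsub>S\<^esub> e)" unfolding w(1) using d e by algebra
    finally have "h (?c \<otimes> b) \<otimes>\<^bsub>S\<^esub> x = h ?c \<otimes>\<^bsub>S\<^esub> w \<oplus>\<^bsub>S\<^esub> h \<nu> \<otimes>\<^bsub>S\<^esub> v" unfolding ce .
    moreover have "h ?c \<otimes>\<^bsub>S\<^esub> w \<in> mod_span S h m J es" "h \<nu> \<otimes>\<^bsub>S\<^esub> v \<in> mod_span S h m J es"
      using mod_span_smult[OF J mc es cc _ w(2)] mod_span_smult[OF J mc es d(2) _ v(2)]
        R.ideal_closed(6)[OF mi] cc d(2) by auto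
    ultimately show ?thesis using mod_span_add[OF J mi es] by simp
  qed
  moreover have "?c \<otimes> b \<notin> m" using R.maximalideal_prod[OF m cc c(3)] cm Cons.prems(2) by blast
  ultimately show ?case using Cons.IH[of "?c \<otimes> b"] Cons.prems(1) cc c(3) by auto
qed

lemma ideal_vimage:
  assumes "ideal J S"
  shows "ideal {a \<in> carrier R. h a \<in> J} R"
proof -
  note I = S.ideal_closed[OF assms]
  show ?thesis
  proof (rule idealI)
    show "ring R" by (rule R.ring_axioms)
    show "subgroup {a \<in> carrier R. h a \<in> J} (add_monoid R)"
      by (rule R.add.subgroupI) (use I in \<open>auto simp: a_inv_def[symmetric]\<close>)
  qed (use I in auto)
qed

text \<open>
  The hypothesis \<open>int\<close> is integrality of \<open>s\<close> modulo \<open>N\<close> in its module form: \<open>Y\<close> plays the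
  part of a finitely generated module that is stable under \<open>s\<close> and contains \<open>\<one>\<close>. If \<open>a\<close> lies in a maximal ideal \<open>m\<close> above the contraction
  but \<open>h a\<close> has an inverse \<open>s\<close> modulo \<open>N\<close>, then modulo \<open>N\<close> each \<open>x \<in> Y\<close> equals
  \<open>a (s x)\<close>, an element of \<open>m Y\<close>, and Nakayama's lemma yields an element of the contraction outside \<open>m\<close>.
\<close>

lemma maximalideal_vimage:
  assumes N: "maximalideal N S"
    and int: "\<And>s. s \<in> carrier S \<Longrightarrow> \<exists>Y es. Y \<subseteq> carrier S \<and> \<one>\<^bsub>S\<^esub> \<in> Y \<and> (\<forall>x\<in>Y. s \<otimes>\<^bsub>S\<^esub> x \<in> Y) \<and>
      set es \<subseteq> Y \<and> Y \<subseteq> mod_span S h (carrier R) N es"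
  shows "maximalideal {a \<in> carrier R. h a \<in> N} R"
proof -
  note Ni = S.maximalideal_ideal[OF N]
  let ?P = "{a \<in> carrier R. h a \<in> N}"
  have P: "ideal ?P R" by (rule ideal_vimage[OF Ni])
  have "\<one> \<notin> ?P" using S.one_notin_maximalideal[OF N] by simp
  then obtain m where m: "maximalideal m R" "?P \<subseteq> m"
    using R.ideal_subset_maximalideal[OF P] by blast
  note mi = R.maximalideal_ideal[OF m(1)]
  have mc: "m \<subseteq> carrier R" using R.ideal_closed(1)[OF mi] by blast
  have "h a \<in> N" if a: "a \<in> m" for a
  proof (rule ccontr)
    assume aN: "h a \<notin> N"
    have ac: "a \<in> carrier R" and hac: "h a \<in> carrier S" using a mc by auto
    obtain s where s: "s \<in> carrier S" "h a \<otimes>\<^bsub>S\<^esub> s \<ominus>\<^bsub>S\<^esub> \<one>\<^bsub>S\<^esub> \<in> N"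
      using S.inverse_mod_maximalideal[OF N hac aN] by blast
    obtain Y es where Y: "Y \<subseteq> carrier S" "\<one>\<^bsub>S\<^esub> \<in> Y" "\<And>x. x \<in> Y \<Longrightarrow> s \<otimes>\<^bsub>S\<^esub> x \<in> Y"
      "set es \<subseteq> Y" "Y \<subseteq> mod_span S h (carrier R) N es"
      using int[OF s(1)] by blast
    have es: "set es \<subseteq> carrier S" using Y by blast
    have "h \<one> \<otimes>\<^bsub>S\<^esub> x \<in> mod_span S h m N es" if x: "x \<in> Y" for x
    proof -
      have xc: "x \<in> carrier S" using x Y by blast
      have "h a \<otimes>\<^bsub>S\<^esub> (s \<otimes>\<^bsub>S\<^esub> x) \<in> mod_span S h m N es"
        using mod_span_smult[OF Ni _ es ac, of "carrier R" m "s \<otimes>\<^bsub>S\<^esub> x"]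
          Y x R.ideal_closed(7)[OF mi a] by blast
      moreover have "(h a \<otimes>\<^bsub>S\<^esub> s \<ominus>\<^bsub>S\<^esub> \<one>\<^bsub>S\<^esub>) \<otimes>\<^bsub>S\<^esub> x \<in> mod_span S h m N es"
        using mod_span_base[OF Ni mi es] S.ideal_closed(7)[OF Ni s(2) xc] by blast
      moreover have "h a \<otimes>\<^bsub>S\<^esub> (s \<otimes>\<^bsub>S\<^esub> x) \<ominus>\<^bsub>S\<^esub> (h a \<otimes>\<^bsub>S\<^esub> s \<ominus>\<^bsub>S\<^esub> \<one>\<^bsub>S\<^esub>) \<otimes>\<^bsub>S\<^esub> x = x"
        using hac s(1) xc by algebra
      ultimately have "x \<in> mod_span S h m N es" using mod_span_minus[OF Ni mi es] by metis
      then show ?thesis using xc by simp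
    qed
    then obtain c where c: "c \<in> carrier R - m" "\<forall>x\<in>Y. h c \<otimes>\<^bsub>S\<^esub> x \<in> N"
      using nakayama_descent[OF m(1) Ni Y(1,4), of \<one>] R.one_notin_maximalideal[OF m(1)] by auto
    then have "h c \<in> N" using Y(2) by force
    then show False using c m(2) by blast
  qed
  then have "m = ?P" using m(2) mc by blast
  then show ?thesis using m(1) by simp
qed

end

section \<open>Counting the maximal ideals over a given one\<close>

text \<open>
  The number of pivots of \<open>I\<close>: a generator \<open>e\<close> counts if \<open>I\<close> contains an element of the span whose
  leading term is a multiple of \<open>e\<close> by a coefficient outside \<open>m\<close>. When \<open>I\<close> contains \<open>J\<close> and
  \<open>J\<close> contains the image of \<open>m\<close>, this is the dimension over the residue field of \<open>m\<close> of the
  preimage of \<open>I\<close> in the free module on the generators, read off from an echelon form.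
\<close>

primrec span_rank :: "('a, 'm) ring_scheme \<Rightarrow> ('b, 'n) ring_scheme \<Rightarrow> ('a \<Rightarrow> 'b) \<Rightarrow> 'a set \<Rightarrow> 'b set \<Rightarrow> 'b set \<Rightarrow> 'b list \<Rightarrow> nat" where
  "span_rank R S h m J I [] = 0"
| "span_rank R S h m J I (e # es) = span_rank R S h m J I es +
    (if \<exists>w\<in>mod_span S h (carrier R) J es. \<exists>a\<in>carrier R - m. w \<oplus>\<^bsub>S\<^esub> h a \<otimes>\<^bsub>S\<^esub> e \<in> I then 1 else 0)"

lemma span_rank_mono: "I \<subseteq> I' \<Longrightarrow> span_rank R S h m J I es \<le> span_rank R S h m J I' es"
  by (induction es) (auto intro: add_le_mono)

context ring_hom_cring begin

text \<open>
  This is Gaussian elimination. If \<open>I\<close> has a pivot at \<open>e\<close>, then a suitable multiple of the pivot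
  element of \<open>I\<close> cancels the leading coefficient of an element of \<open>I'\<close> up to an element of
  \<open>m\<close>, and the remainder is handled by the generators after \<open>e\<close>.
\<close>

lemma span_rank_eq_imp_subset:
  assumes m: "maximalideal m R" "\<And>a. a \<in> m \<Longrightarrow> h a \<in> J"
    and I: "ideal J S" "ideal I S" "ideal I' S" "J \<subseteq> I" "I \<subseteq> I'"
    and "set es \<subseteq> carrier S" "span_rank R S h m J I es = span_rank R S h m J I' es"
  shows "I' \<inter> mod_span S h (carrier R) J es \<subseteq> I"
  using assms(8-)
proof (induction es)
  case Nil
  then show ?case using I by auto
next
  case (Cons e es)
  note mi = R.maximalideal_ideal[OF m(1)]
  let ?L = "\<lambda>I. \<exists>w\<in>mod_span S h (carrier R) J es. \<exists>a\<in>carrier R - m. w \<oplus>\<^bsub>S\<^esub> h a \<otimes>\<^bsub>S\<^esub> e \<in> I"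
  have es: "set es \<subseteq> carrier S" and e: "e \<in> carrier S" using Cons.prems by auto
  have "?L I \<Longrightarrow> ?L I'" using I(5) by blast
  then have eq: "span_rank R S h m J I es = span_rank R S h m J I' es" and L: "?L I' \<Longrightarrow> ?L I"
    using Cons.prems(2) span_rank_mono[OF I(5), of R S h m J es] by (auto split: if_splits)
  note IH = Cons.IH[OF es eq]
  have sub: "mod_span S h (carrier R) J es \<subseteq> carrier S" using mod_span_subset[OF I(1) _ es] by simp
  show ?case
  proof
    fix f assume f: "f \<in> I' \<inter> mod_span S h (carrier R) J (e # es)"
    then obtain w a where w: "f = w \<oplus>\<^bsub>S\<^esub> h a \<otimes>\<^bsub>S\<^esub> e" "w \<in> mod_span S h (carrier R) J es" "a \<in> carrier R"
      by auto
    have wc: "w \<in> carrier S" "h a \<in> carrier S" using w sub by auto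
    have small: "w' \<oplus>\<^bsub>S\<^esub> h a' \<otimes>\<^bsub>S\<^esub> e \<in> I"
      if w': "w' \<in> mod_span S h (carrier R) J es" "a' \<in> m" "w' \<oplus>\<^bsub>S\<^esub> h a' \<otimes>\<^bsub>S\<^esub> e \<in> I'" for w' a'
    proof -
      have ac: "a' \<in> carrier R" and w'c: "w' \<in> carrier S" using R.ideal_closed(1)[OF mi w'(2)] w' sub by auto
      have "h a' \<otimes>\<^bsub>S\<^esub> e \<in> J" using m(2)[OF w'(2)] S.ideal_closed(7)[OF I(1)] e by blast
      then have ae: "h a' \<otimes>\<^bsub>S\<^esub> e \<in> I" using I by blast
      have "(w' \<oplus>\<^bsub>S\<^esub> h a' \<otimes>\<^bsub>S\<^esub> e) \<ominus>\<^bsub>S\<^esub> h a' \<otimes>\<^bsub>S\<^esub> e = w'"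
        using w'c e hom_closed[OF ac] by algebra
      then have "w' \<in> I'" using S.ideal_closed(5)[OF I(3) w'(3)] ae I(5) by (metis subsetD)
      then have "w' \<in> I" using IH w' by blast
      then show ?thesis using ae S.ideal_closed(3)[OF I(2)] by blast
    qed
    show "f \<in> I"
    proof (cases "a \<in> m")
      case True
      then show ?thesis using small w f by auto
    next
      case False
      then have "?L I'" using w f by blast
      then obtain v b where v: "v \<in> mod_span S h (carrier R) J es" "b \<in> carrier R" "b \<notin> m"
        "v \<oplus>\<^bsub>S\<^esub> h b \<otimes>\<^bsub>S\<^esub> e \<in> I" using L by blast
      \<comment> \<open>The pivot coefficient \<open>b\<close> is inverted modulo \<open>m\<close>, and \<open>a c\<close> times the pivot element has leading
        coefficient \<open>a\<close> up to an element of \<open>m\<close>.\<close>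
      obtain c where c: "c \<in> carrier R" "b \<otimes> c \<ominus> \<one> \<in> m"
        using R.inverse_mod_maximalideal[OF m(1) v(2,3)] by blast
      let ?r = "a \<otimes> c" let ?g = "h ?r \<otimes>\<^bsub>S\<^esub> (v \<oplus>\<^bsub>S\<^esub> h b \<otimes>\<^bsub>S\<^esub> e)"
      have r: "?r \<in> carrier R" using w c by simp
      have vc: "v \<in> carrier S" "h b \<in> carrier S" "h ?r \<in> carrier S" using v r sub by auto
      have g: "?g \<in> I" using S.ideal_closed(6)[OF I(2) v(4) vc(3)] .
      have "a \<ominus> ?r \<otimes> b = \<ominus> (a \<otimes> (b \<otimes> c \<ominus> \<one>))" using w(3) c(1) v(2) by algebra
      then have am: "a \<ominus> ?r \<otimes> b \<in> m" using R.ideal_closed(4,6)[OF mi] c w(3) by auto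
      have "f \<ominus>\<^bsub>S\<^esub> ?g = (w \<ominus>\<^bsub>S\<^esub> h ?r \<otimes>\<^bsub>S\<^esub> v) \<oplus>\<^bsub>S\<^esub> (h a \<ominus>\<^bsub>S\<^esub> h ?r \<otimes>\<^bsub>S\<^esub> h b) \<otimes>\<^bsub>S\<^esub> e"
        unfolding w(1) using wc vc e by algebra
      also have "h a \<ominus>\<^bsub>S\<^esub> h ?r \<otimes>\<^bsub>S\<^esub> h b = h (a \<ominus> ?r \<otimes> b)" using w(3) r v(2) by (simp add: a_minus_def)
      finally have fg: "f \<ominus>\<^bsub>S\<^esub> ?g = (w \<ominus>\<^bsub>S\<^esub> h ?r \<otimes>\<^bsub>S\<^esub> v) \<oplus>\<^bsub>S\<^esub> h (a \<ominus> ?r \<otimes> b) \<otimes>\<^bsub>S\<^esub> e" .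
      have "h ?r \<otimes>\<^bsub>S\<^esub> v \<in> mod_span S h (carrier R) J es"
        using mod_span_smult[OF I(1) _ es r _ v(1)] r by simp
      then have wv: "w \<ominus>\<^bsub>S\<^esub> h ?r \<otimes>\<^bsub>S\<^esub> v \<in> mod_span S h (carrier R) J es"
        using mod_span_minus[OF I(1) R.oneideal es w(2)] by blast
      have "f \<ominus>\<^bsub>S\<^esub> ?g \<in> I'" using S.ideal_closed(5)[OF I(3)] f g I(5) by blast
      then have "f \<ominus>\<^bsub>S\<^esub> ?g \<in> I" using small[OF wv am] unfolding fg by blast
      then have "(f \<ominus>\<^bsub>S\<^esub> ?g) \<oplus>\<^bsub>S\<^esub> ?g \<in> I" using S.ideal_closed(3)[OF I(2)] g by blast
      moreover have "f \<in> carrier S" "?g \<in> carrier S" using f S.ideal_closed(1) I g by auto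
      then have "(f \<ominus>\<^bsub>S\<^esub> ?g) \<oplus>\<^bsub>S\<^esub> ?g = f" by algebra
      ultimately show ?thesis by simp
    qed
  qed
qed

text \<open>
  The intersections of the first \<open>n\<close> members of an infinite sequence in \<open>F\<close> would decrease strictly,
  by prime avoidance, and so would their ranks, which are natural numbers.
\<close>

lemma finite_maximalideals_over:
  assumes m: "maximalideal m R" and F: "\<And>N. N \<in> F \<Longrightarrow> maximalideal N S"
    "\<And>N a. N \<in> F \<Longrightarrow> a \<in> m \<Longrightarrow> h a \<in> N"
    and es: "set es \<subseteq> carrier S"
    "carrier S \<subseteq> mod_span S h (carrier R) {x \<in> carrier S. \<forall>N\<in>F. x \<in> N} es"
  shows "finite F"
proof (rule ccontr)
  assume "infinite F"
  then obtain f :: "nat \<Rightarrow> 'c set" where f: "inj f" "range f \<subseteq> F"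
    using infinite_countable_subset by blast
  let ?J = "{x \<in> carrier S. \<forall>N\<in>F. x \<in> N}"
  define I where "I n = {x \<in> carrier S. \<forall>N\<in>f ` {..<n}. x \<in> N}" for n
  have fF: "f i \<in> F" for i using f by blast
  have Ii: "ideal (I n) S" for n
    unfolding I_def by (rule S.ideal_Inter_maximalideals) (use fF F in auto)
  have Ji: "ideal ?J S" by (rule S.ideal_Inter_maximalideals) (use F in auto)
  have JI: "?J \<subseteq> I n" for n using fF by (auto simp: I_def)
  have hJ: "h a \<in> ?J" if "a \<in> m" for a
    using that F(2) R.ideal_closed(1)[OF R.maximalideal_ideal[OF m]] by auto
  let ?r = "\<lambda>n. span_rank R S h m ?J (I n) es"
  have "?r (Suc n) < ?r n" for n
  proof -
    have sub: "I (Suc n) \<subseteq> I n" unfolding I_def by (auto simp: lessThan_Suc)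
    obtain u where u: "u \<in> carrier S" "\<forall>M\<in>f ` {..<n}. u \<in> M" "u \<notin> f n"
    proof (rule bexE[OF S.maximalideals_avoidance[of "f ` {..<n}" "f n"]])
      show "f n \<notin> f ` {..<n}" using f(1) by (auto dest: injD)
    qed (use fF F in auto)
    then have "u \<in> I n" "u \<notin> I (Suc n)" by (auto simp: I_def)
    then have "?r (Suc n) \<noteq> ?r n"
      using span_rank_eq_imp_subset[OF m hJ Ji Ii Ii JI sub es(1)] es(2) u(1) by blast
    then show ?thesis using span_rank_mono[OF sub, of R S h m ?J es] by simp
  qed
  then have "\<exists>f :: nat \<Rightarrow> nat. \<forall>n. f (Suc n) < f n" by (intro exI[of _ ?r]) blast
  then show False using wf_less wf_iff_no_infinite_down_chain[of "{(x, y). x < (y::nat)}"] by auto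
qed

end

section \<open>Residue characteristics\<close>

text \<open>
  In this form the characteristic of a quotient is described by the multiples of \<open>\<one>\<close> in the ideal,
  so that cosets need not be mentioned again.
\<close>

lemma (in cring) ring_characteristic_Quot_dvd:
  assumes I: "ideal I R"
  shows "ring_characteristic (R Quot I) dvd n \<longleftrightarrow> [n] \<cdot> \<one> \<in> I"
proof -
  interpret I: ideal I R by fact
  have zero: "\<zero>\<^bsub>R Quot I\<^esub> = I" by (simp add: FactRing_def)
  interpret q: ring_hom_cring R "R Quot I" "(+>) I"
    using I.rcos_ring_hom_cring[OF is_cring] .
  have hom: "I +> [n] \<cdot> \<one> = [n] \<cdot>\<^bsub>R Quot I\<^esub> \<one>\<^bsub>R Quot I\<^esub>"
    by (induction n) auto
  have "ring_characteristic (R Quot I) dvd n \<longleftrightarrow> [n] \<cdot>\<^bsub>R Quot I\<^esub> \<one>\<^bsub>R Quot I\<^esub> = \<zero>\<^bsub>R Quot I\<^esub>"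
    unfolding ring_characteristic_def
    using q.S.add.pow_eq_id[of "\<one>\<^bsub>R Quot I\<^esub>" n] by simp
  also have "\<dots> \<longleftrightarrow> I +> [n] \<cdot> \<one> = I" by (simp only: hom zero)
  also have "\<dots> \<longleftrightarrow> [n] \<cdot> \<one> \<in> I"
    using I.a_rcos_self[of "[n] \<cdot> \<one>"] I.a_rcos_const by auto
  finally show ?thesis .
qed

lemma (in cring) ideal_jacobson_radical: "ideal (jacobson_radical R) R"
  using ideal_Inter_maximalideals[of "{M. maximalideal M R}"] by (simp add: jacobson_radical_def)

context cring begin

lemma nat_multiple_mult: "[(m * n :: nat)] \<cdot> \<one> = ([m] \<cdot> \<one>) \<otimes> ([n] \<cdot> \<one>)"
  by (simp add: add_pow_ldistr add_pow_rdistr add.nat_pow_pow mult.commute)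

lemma ring_characteristic_Quot_maximalideal:
  assumes m: "maximalideal m R"
  shows "ring_characteristic (R Quot m) = 0 \<or> Factorial_Ring.prime (ring_characteristic (R Quot m))"
proof (cases "ring_characteristic (R Quot m) = 0")
  case False
  let ?c = "ring_characteristic (R Quot m)"
  note dvd = ring_characteristic_Quot_dvd[OF maximalideal_ideal[OF m]]
  have "?c \<noteq> 1" using dvd[of 1] one_notin_maximalideal[OF m] by auto
  then obtain q where q: "Factorial_Ring.prime q" "q dvd ?c" using prime_factor_nat by blast
  then obtain k where k: "?c = q * k" by blast
  have "([q] \<cdot> \<one>) \<otimes> ([k] \<cdot> \<one>) \<in> m"
    using dvd[of "q * k"] k unfolding nat_multiple_mult by simp
  then have "[q] \<cdot> \<one> \<in> m \<or> [k] \<cdot> \<one> \<in> m" using maximalideal_prod[OF m] by auto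
  \<comment> \<open>Since \<open>k\<close> is a proper divisor of the characteristic, the second alternative is impossible.\<close>
  moreover have "\<not> ?c dvd k"
    using k False prime_gt_1_nat[OF q(1)] by (auto dest!: dvd_imp_le)
  ultimately have "?c dvd q" using dvd by blast
  then have "?c = q" using q(2) dvd_antisym by blast
  then show ?thesis using q(1) by simp
qed simp

end

section \<open>Finite subgroups and primary parts\<close>

lemma (in group) ord_in_subgroup:
  assumes "subgroup H G" "x \<in> H"
  shows "group.ord (G\<lparr>carrier := H\<rparr>) x = ord x"
proof -
  interpret H: group "G\<lparr>carrier := H\<rparr>" using subgroup_imp_group assms by blast
  have "x \<in> carrier G" using assms subgroup.subset by blast
  then show ?thesis
    using assms(2) by (subst H.ord_unique) (auto simp: pow_eq_id nat_pow_consistent[of _ _ H, symmetric])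
qed

text \<open>
  The minimality of \<open>H'\<close> keeps a chain of such extensions inside a given subgroup.
\<close>

lemma (in comm_group) finite_subgroup_adjoin:
  assumes H: "subgroup H G" "finite H" and x: "x \<in> carrier G" "ord x \<noteq> 0"
  shows "\<exists>H'. subgroup H' G \<and> finite H' \<and> H \<subseteq> H' \<and> x \<in> H' \<and>
    (\<forall>K. subgroup K G \<longrightarrow> H \<subseteq> K \<longrightarrow> x \<in> K \<longrightarrow> H' \<subseteq> K)"
proof (intro exI conjI allI impI)
  let ?X = "generate G {x}"
  have sX: "subgroup ?X G" using generate_is_subgroup x by simp
  have "finite ?X"
    using generate_pow_card[OF x(1)] x(2) by (metis card.infinite)
  then have "finite ((\<lambda>(h, y). h \<otimes> y) ` (H \<times> ?X))" using H(2) by blast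
  moreover have "H <#> ?X = (\<lambda>(h, y). h \<otimes> y) ` (H \<times> ?X)" by (auto simp: set_mult_def)
  ultimately show "finite (H <#> ?X)" by simp
  show "subgroup (H <#> ?X) G" using mult_subgroups H(1) sX by blast
  show "H \<subseteq> H <#> ?X"
  proof
    fix h assume h: "h \<in> H"
    then have "h \<otimes> \<one> \<in> H <#> ?X" unfolding set_mult_def using subgroup.one_closed[OF sX] by blast
    then show "h \<in> H <#> ?X" using h subgroup.mem_carrier[OF H(1)] by simp
  qed
  show "x \<in> H <#> ?X"
  proof -
    have "\<one> \<otimes> x \<in> H <#> ?X"
      unfolding set_mult_def using subgroup.one_closed[OF H(1)] generate.incl[of x "{x}" G] by blast
    then show ?thesis using x by simp
  qed
  show "H <#> ?X \<subseteq> K" if K: "subgroup K G" "H \<subseteq> K" "x \<in> K" for K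
  proof -
    have "?X \<subseteq> K" using generate_subgroup_incl[of "{x}" K] K by blast
    then show ?thesis using K unfolding set_mult_def by (auto intro: subgroup.m_closed)
  qed
qed

lemma (in comm_group) finite_subset_finite_subgroup:
  assumes tors: "\<And>x. x \<in> carrier G \<Longrightarrow> ord x \<noteq> 0" and "finite F" "F \<subseteq> carrier G"
  shows "\<exists>H. subgroup H G \<and> finite H \<and> F \<subseteq> H"
  using assms(2,3)
proof (induction F)
  case empty
  then show ?case using triv_subgroup by blast
next
  case (insert x F)
  then obtain H where H: "subgroup H G" "finite H" "F \<subseteq> H" by auto
  have x: "x \<in> carrier G" "ord x \<noteq> 0" using tors insert.prems by auto
  obtain H' where "subgroup H' G" "finite H'" "H \<subseteq> H'" "x \<in> H'"
    using finite_subgroup_adjoin[OF H(1,2) x] by blast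
  then show ?case using H by (intro exI[of _ H']) auto
qed

lemma (in group) finite_subgroup_cauchy:
  assumes H: "subgroup H G" "finite H" and p: "Factorial_Ring.prime p" "p dvd card H"
  shows "\<exists>x\<in>H. ord x = p"
proof -
  interpret H: group "G\<lparr>carrier := H\<rparr>" using subgroup_imp_group H(1) .
  obtain m where "card H = p * m" using p(2) by blast
  then obtain K where K: "subgroup K (G\<lparr>carrier := H\<rparr>)" "card K = p"
    using sylow_thm[of p "G\<lparr>carrier := H\<rparr>" 1 m] p(1) H(2) H.is_group by (auto simp: order_def)
  have KH: "K \<subseteq> H" using subgroup.subset[OF K(1)] by simp
  have sK: "subgroup K G" using K(1) H(1) incl_subgroup by blast
  have "\<not> K \<subseteq> {\<one>}"
    using K(2) prime_gt_1_nat[OF p(1)] card_mono[of "{\<one>}" K] by auto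
  then obtain x where x: "x \<in> K" "x \<noteq> \<one>" by blast
  have xc: "x \<in> carrier G" using x(1) KH H subgroup.subset by blast
  interpret K: group "G\<lparr>carrier := K\<rparr>" using subgroup_imp_group sK .
  have "finite K" using KH H(2) finite_subset by blast
  then have "group.ord (G\<lparr>carrier := K\<rparr>) x dvd p"
    using K.ord_dvd_group_order[of x] x(1) K(2) by (simp add: order_def)
  then have "ord x dvd p" using ord_in_subgroup[OF sK x(1)] by simp
  moreover have "ord x \<noteq> 1" using ord_eq_1 xc x(2) by blast
  ultimately have "ord x = p" using p(1) by (auto simp: prime_nat_iff)
  then show ?thesis using x KH by blast
qed

text \<open>
  If \<open>ord x = p\<^sup>k r\<close> with \<open>r\<close> prime to \<open>p\<close> and \<open>r a = p\<^sup>k b + 1\<close>, then \<open>x\<close> is the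
  product of \<open>x\<^sup>r\<^sup>a\<close>, whose order divides \<open>p\<^sup>k\<close>, and of the inverse of \<open>x\<close> to the power
  \<open>p\<^sup>k b\<close>, whose order divides \<open>r\<close>.
\<close>

lemma (in comm_group) primary_decomposition:
  assumes x: "x \<in> carrier G" "ord x \<noteq> 0" and p: "Factorial_Ring.prime p"
  shows "\<exists>y\<in>carrier G. \<exists>z\<in>carrier G. x = y \<otimes> z \<and> (\<exists>k. ord y = p ^ k) \<and> \<not> p dvd ord z"
proof -
  obtain k r where r: "ord x = p ^ k * r" "\<not> p dvd r"
    using multiplicity_decompose'[of "ord x" p] x(2) p by (metis not_prime_unit)
  have r0: "r \<noteq> 0" using r x(2) by auto
  have "coprime r (p ^ k)"
    using r(2) p prime_imp_coprime[of p r] by (simp add: coprime_commute)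
  then obtain a b where ab: "r * a = p ^ k * b + 1" using bezout_nat[of r "p ^ k"] r0 by auto
  let ?y = "x [^] (r * a)" let ?w = "x [^] (p ^ k * b)"
  have yw: "?y = ?w \<otimes> x" unfolding ab by simp
  have c: "?y \<in> carrier G" "?w \<in> carrier G" using x by auto
  have "?y [^] (p ^ k) = x [^] (ord x * a)" using x(1) r(1) by (simp add: nat_pow_pow mult_ac)
  also have "\<dots> = \<one>" using x(1) by (simp add: pow_eq_id)
  finally have "ord ?y dvd p ^ k" using pow_eq_id c by simp
  then have 1: "\<exists>k. ord ?y = p ^ k" using divides_primepow_nat[OF p] by blast
  have "?w [^] r = x [^] (ord x * b)" using x(1) r(1) by (simp add: nat_pow_pow mult_ac)
  also have "\<dots> = \<one>" using x(1) by (simp add: pow_eq_id)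
  finally have "ord (inv ?w) dvd r" using pow_eq_id c by simp
  then have 2: "\<not> p dvd ord (inv ?w)" using r(2) dvd_trans by blast
  have "x = ?y \<otimes> inv ?w"
    using x c unfolding yw by (simp add: m_comm[of ?w x] m_assoc)
  then show ?thesis using 1 2 c by blast
qed

lemma (in group) pow_inj_infinite_order:
  assumes "x \<in> carrier G" "ord x = 0"
  shows "x [^] (m::nat) = x [^] (n::nat) \<longleftrightarrow> m = n"
  using int_pow_eq[of x "int m" "int n"] assms by (auto simp: int_pow_int)

section \<open>The group ring\<close>

definition monomial :: "('a, 'm) ring_scheme \<Rightarrow> ('g, 'n) monoid_scheme \<Rightarrow> 'a \<Rightarrow> 'g \<Rightarrow> 'g \<Rightarrow> 'a"
  where "monomial A G a g = (\<lambda>x\<in>carrier G. if x = g then a else \<zero>\<^bsub>A\<^esub>)"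

locale comm_group_ring = A: cring A + G: comm_group G
  for A :: "('a, 'm) ring_scheme" (structure) and G :: "('g, 'n) monoid_scheme" (structure) +
  assumes one_not_zero: "\<one>\<^bsub>A\<^esub> \<noteq> \<zero>\<^bsub>A\<^esub>"
begin

abbreviation S where "S \<equiv> group_ring A G"
abbreviation mono where "mono \<equiv> monomial A G"
abbreviation supp where "supp f \<equiv> {x \<in> carrier G. f x \<noteq> \<zero>\<^bsub>A\<^esub>}"

lemma carrier_iff: "f \<in> carrier S \<longleftrightarrow> f \<in> carrier G \<rightarrow>\<^sub>E carrier A \<and> finite (supp f)"
  by (simp add: group_ring_def)

lemma value_closed [simp, intro]: "f \<in> carrier S \<Longrightarrow> x \<in> carrier G \<Longrightarrow> f x \<in> carrier A"
  by (auto simp: carrier_iff)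

lemma finite_supp: "f \<in> carrier S \<Longrightarrow> finite (supp f)"
  by (simp add: carrier_iff)

lemma carrierI:
  assumes "f \<in> extensional (carrier G)" "\<And>x. x \<in> carrier G \<Longrightarrow> f x \<in> carrier A"
    "finite F" "\<And>x. x \<in> carrier G \<Longrightarrow> f x \<noteq> \<zero>\<^bsub>A\<^esub> \<Longrightarrow> x \<in> F"
  shows "f \<in> carrier S"
  using assms(1,2) finite_subset[OF _ assms(3), of "supp f"] assms(4)
  by (auto simp: carrier_iff PiE_iff)

lemma add_eq: "f \<oplus>\<^bsub>S\<^esub> g = (\<lambda>x\<in>carrier G. f x \<oplus>\<^bsub>A\<^esub> g x)"
  by (simp add: group_ring_def)

lemma add_apply [simp]: "x \<in> carrier G \<Longrightarrow> (f \<oplus>\<^bsub>S\<^esub> g) x = f x \<oplus>\<^bsub>A\<^esub> g x"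
  by (simp add: add_eq)

lemma zero_apply [simp]: "x \<in> carrier G \<Longrightarrow> \<zero>\<^bsub>S\<^esub> x = \<zero>\<^bsub>A\<^esub>"
  by (simp add: group_ring_def)

lemma one_eq: "\<one>\<^bsub>S\<^esub> = mono \<one>\<^bsub>A\<^esub> \<one>\<^bsub>G\<^esub>"
  by (simp add: group_ring_def monomial_def)

lemma mono_apply [simp]: "x \<in> carrier G \<Longrightarrow> mono a g x = (if x = g then a else \<zero>\<^bsub>A\<^esub>)"
  by (simp add: monomial_def)

lemma mult_eq: "f \<otimes>\<^bsub>S\<^esub> g = (\<lambda>x\<in>carrier G. \<Oplus>\<^bsub>A\<^esub>y\<in>supp f. f y \<otimes>\<^bsub>A\<^esub> g (inv\<^bsub>G\<^esub> y \<otimes>\<^bsub>G\<^esub> x))"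
  by (simp add: group_ring_def)

lemma extensionality:
  assumes "f \<in> extensional (carrier G)" "g \<in> extensional (carrier G)"
    "\<And>x. x \<in> carrier G \<Longrightarrow> f x = g x"
  shows "f = g"
  using assms by (rule extensionalityI)

lemma extensional [simp, intro]:
  "f \<in> carrier S \<Longrightarrow> f \<in> extensional (carrier G)" "f \<oplus>\<^bsub>S\<^esub> g \<in> extensional (carrier G)"
  "f \<otimes>\<^bsub>S\<^esub> g \<in> extensional (carrier G)" "mono a x \<in> extensional (carrier G)"
  by (auto simp: carrier_iff add_eq mult_eq monomial_def PiE_iff)

lemma mono_closed [simp, intro]: "a \<in> carrier A \<Longrightarrow> mono a g \<in> carrier S"
  by (rule carrierI[of _ "{g}"]) (auto split: if_splits)

lemma add_closed [simp, intro]: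
  assumes "f \<in> carrier S" "g \<in> carrier S" shows "f \<oplus>\<^bsub>S\<^esub> g \<in> carrier S"
  by (rule carrierI[of _ "supp f \<union> supp g"]) (use assms finite_supp in auto)

lemma zero_closed [simp, intro]: "\<zero>\<^bsub>S\<^esub> \<in> carrier S"
  by (auto simp: group_ring_def)

lemma abelian_group_group_ring: "abelian_group S"
proof (rule abelian_groupI)
  fix f g h assume f: "f \<in> carrier S" and g: "g \<in> carrier S" and h: "h \<in> carrier S"
  show "(f \<oplus>\<^bsub>S\<^esub> g) \<oplus>\<^bsub>S\<^esub> h = f \<oplus>\<^bsub>S\<^esub> (g \<oplus>\<^bsub>S\<^esub> h)"
    by (rule extensionality) (use f g h A.a_assoc in auto)
  show "f \<oplus>\<^bsub>S\<^esub> g = g \<oplus>\<^bsub>S\<^esub> f"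
    by (rule extensionality) (use f g A.a_comm in auto)
next
  fix f assume f: "f \<in> carrier S"
  show "\<zero>\<^bsub>S\<^esub> \<oplus>\<^bsub>S\<^esub> f = f"
    by (rule extensionality) (use f in auto)
  let ?g = "\<lambda>x\<in>carrier G. \<ominus>\<^bsub>A\<^esub> f x"
  have "?g \<in> carrier S"
    by (rule carrierI[of _ "supp f"]) (use f finite_supp in auto)
  moreover have "?g \<oplus>\<^bsub>S\<^esub> f = \<zero>\<^bsub>S\<^esub>"
    by (rule extensionality) (use f A.l_neg in auto)
  ultimately show "\<exists>g\<in>carrier S. g \<oplus>\<^bsub>S\<^esub> f = \<zero>\<^bsub>S\<^esub>" by blast
qed auto

text \<open>
  The monomials generate the group ring additively. With this principle, multilinear
  identities of the convolution product only have to be verified on monomials, and double sums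
  do not have to be interchanged.
\<close>

lemma group_ring_induct [consumes 1, case_names zero mono add]:
  assumes "f \<in> carrier S" and zero: "P \<zero>\<^bsub>S\<^esub>"
    and mono: "\<And>a g. a \<in> carrier A \<Longrightarrow> g \<in> carrier G \<Longrightarrow> P (mono a g)"
    and add: "\<And>f g. f \<in> carrier S \<Longrightarrow> g \<in> carrier S \<Longrightarrow> P f \<Longrightarrow> P g \<Longrightarrow> P (f \<oplus>\<^bsub>S\<^esub> g)"
  shows "P f"
proof -
  have "P f" if "finite F" "f \<in> carrier S" "supp f \<subseteq> F" "F \<subseteq> carrier G" for F f
    using that
  proof (induction F arbitrary: f)
    case empty
    then have "f = \<zero>\<^bsub>S\<^esub>" by (intro extensionality) auto
    then show ?case using zero by simp
  next
    case (insert g F)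
    let ?h = "\<lambda>x\<in>carrier G. if x = g then \<zero>\<^bsub>A\<^esub> else f x"
    have g: "g \<in> carrier G" using insert.prems by blast
    have h: "?h \<in> carrier S"
      by (rule carrierI[of _ F]) (use insert in \<open>auto split: if_splits\<close>)
    have "f = mono (f g) g \<oplus>\<^bsub>S\<^esub> ?h"
      by (rule extensionality) (use insert.prems g in auto)
    moreover have "P ?h"
      by (rule insert.IH[OF h]) (use insert.prems in \<open>auto split: if_splits\<close>)
    ultimately show ?case using mono[of "f g" g] add[of "mono (f g) g" ?h] h insert.prems(1) g by auto
  qed
  then show ?thesis using assms(1) finite_supp by blast
qed

text \<open>
  The convolution may be summed over any finite set that contains the support of the left factor; a
  common index set for two factors is what additivity in the left argument needs.
\<close>

lemma mult_apply:
  assumes "f \<in> carrier S" "g \<in> carrier S" "x \<in> carrier G"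
    and "finite Y" "Y \<subseteq> carrier G" "supp f \<subseteq> Y"
  shows "(f \<otimes>\<^bsub>S\<^esub> g) x = (\<Oplus>\<^bsub>A\<^esub>y\<in>Y. f y \<otimes>\<^bsub>A\<^esub> g (inv\<^bsub>G\<^esub> y \<otimes>\<^bsub>G\<^esub> x))"
proof -
  have "(\<Oplus>\<^bsub>A\<^esub>y\<in>supp f. f y \<otimes>\<^bsub>A\<^esub> g (inv\<^bsub>G\<^esub> y \<otimes>\<^bsub>G\<^esub> x)) = (\<Oplus>\<^bsub>A\<^esub>y\<in>Y. f y \<otimes>\<^bsub>A\<^esub> g (inv\<^bsub>G\<^esub> y \<otimes>\<^bsub>G\<^esub> x))"
    by (rule A.add.finprod_mono_neutral_cong_left) (use assms in auto)
  then show ?thesis using assms(3) by (simp add: mult_eq)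
qed

lemma mono_mult_apply [simp]:
  assumes "a \<in> carrier A" "g \<in> carrier G" "f \<in> carrier S" "x \<in> carrier G"
  shows "(mono a g \<otimes>\<^bsub>S\<^esub> f) x = a \<otimes>\<^bsub>A\<^esub> f (inv\<^bsub>G\<^esub> g \<otimes>\<^bsub>G\<^esub> x)"
  using assms by (subst mult_apply[of _ _ _ "{g}"]) (auto split: if_splits)

lemma mono_mult_closed:
  assumes "a \<in> carrier A" "g \<in> carrier G" "f \<in> carrier S"
  shows "mono a g \<otimes>\<^bsub>S\<^esub> f \<in> carrier S"
proof (rule carrierI)
  show "finite ((\<lambda>y. g \<otimes>\<^bsub>G\<^esub> y) ` supp f)" using finite_supp[OF assms(3)] by simp
  fix x assume x: "x \<in> carrier G" "(mono a g \<otimes>\<^bsub>S\<^esub> f) x \<noteq> \<zero>\<^bsub>A\<^esub>"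
  then have "inv\<^bsub>G\<^esub> g \<otimes>\<^bsub>G\<^esub> x \<in> supp f" using assms by auto
  moreover have "x = g \<otimes>\<^bsub>G\<^esub> (inv\<^bsub>G\<^esub> g \<otimes>\<^bsub>G\<^esub> x)" using x assms by (simp add: G.m_assoc[symmetric])
  ultimately show "x \<in> (\<lambda>y. g \<otimes>\<^bsub>G\<^esub> y) ` supp f" by blast
qed (use assms in auto)

lemma mult_l_distr:
  assumes "f \<in> carrier S" "g \<in> carrier S" "h \<in> carrier S"
  shows "(f \<oplus>\<^bsub>S\<^esub> g) \<otimes>\<^bsub>S\<^esub> h = f \<otimes>\<^bsub>S\<^esub> h \<oplus>\<^bsub>S\<^esub> g \<otimes>\<^bsub>S\<^esub> h"
proof (rule extensionality)
  fix x assume x: "x \<in> carrier G"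
  let ?Y = "supp f \<union> supp g"
  have Y: "finite ?Y" "?Y \<subseteq> carrier G" using assms finite_supp by auto
  have s: "supp (f \<oplus>\<^bsub>S\<^esub> g) \<subseteq> ?Y" by auto
  have "((f \<oplus>\<^bsub>S\<^esub> g) \<otimes>\<^bsub>S\<^esub> h) x = (\<Oplus>\<^bsub>A\<^esub>y\<in>?Y. (f \<oplus>\<^bsub>S\<^esub> g) y \<otimes>\<^bsub>A\<^esub> h (inv\<^bsub>G\<^esub> y \<otimes>\<^bsub>G\<^esub> x))"
    by (rule mult_apply) (use assms x Y s in auto)
  also have "\<dots> = (\<Oplus>\<^bsub>A\<^esub>y\<in>?Y. f y \<otimes>\<^bsub>A\<^esub> h (inv\<^bsub>G\<^esub> y \<otimes>\<^bsub>G\<^esub> x) \<oplus>\<^bsub>A\<^esub> g y \<otimes>\<^bsub>A\<^esub> h (inv\<^bsub>G\<^esub> y \<otimes>\<^bsub>G\<^esub> x))"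
    by (rule A.finsum_cong') (use assms x in \<open>auto simp: A.l_distr\<close>)
  also have "\<dots> = (f \<otimes>\<^bsub>S\<^esub> h) x \<oplus>\<^bsub>A\<^esub> (g \<otimes>\<^bsub>S\<^esub> h) x"
    using assms x Y
    by (subst A.finsum_addf, force, force)
      (simp add: mult_apply[of f h x ?Y] mult_apply[of g h x ?Y])
  finally show "((f \<oplus>\<^bsub>S\<^esub> g) \<otimes>\<^bsub>S\<^esub> h) x = (f \<otimes>\<^bsub>S\<^esub> h \<oplus>\<^bsub>S\<^esub> g \<otimes>\<^bsub>S\<^esub> h) x" using x by simp
qed auto

lemma zero_mult: "f \<in> carrier S \<Longrightarrow> \<zero>\<^bsub>S\<^esub> \<otimes>\<^bsub>S\<^esub> f = \<zero>\<^bsub>S\<^esub>"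
  by (intro extensionality) (auto simp: mult_eq group_ring_def)

lemma mult_closed [simp, intro]:
  assumes "f \<in> carrier S" "g \<in> carrier S" shows "f \<otimes>\<^bsub>S\<^esub> g \<in> carrier S"
  using assms(1)
  by (induction rule: group_ring_induct)
    (use assms in \<open>auto simp: zero_mult mono_mult_closed mult_l_distr\<close>)

lemma mult_r_distr:
  assumes "f \<in> carrier S" "g \<in> carrier S" "h \<in> carrier S"
  shows "h \<otimes>\<^bsub>S\<^esub> (f \<oplus>\<^bsub>S\<^esub> g) = h \<otimes>\<^bsub>S\<^esub> f \<oplus>\<^bsub>S\<^esub> h \<otimes>\<^bsub>S\<^esub> g"
proof (rule extensionality)
  fix x assume x: "x \<in> carrier G"
  have Y: "finite (supp h)" "supp h \<subseteq> carrier G" using assms finite_supp by auto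
  have "(h \<otimes>\<^bsub>S\<^esub> (f \<oplus>\<^bsub>S\<^esub> g)) x = (\<Oplus>\<^bsub>A\<^esub>y\<in>supp h. h y \<otimes>\<^bsub>A\<^esub> f (inv\<^bsub>G\<^esub> y \<otimes>\<^bsub>G\<^esub> x) \<oplus>\<^bsub>A\<^esub> h y \<otimes>\<^bsub>A\<^esub> g (inv\<^bsub>G\<^esub> y \<otimes>\<^bsub>G\<^esub> x))"
    unfolding mult_eq using x
    by (simp, intro A.finsum_cong') (use assms x in \<open>auto simp: A.r_distr\<close>)
  also have "\<dots> = (h \<otimes>\<^bsub>S\<^esub> f) x \<oplus>\<^bsub>A\<^esub> (h \<otimes>\<^bsub>S\<^esub> g) x"
    using assms x Y
    by (subst A.finsum_addf, force, force) (simp add: mult_eq)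
  finally show "(h \<otimes>\<^bsub>S\<^esub> (f \<oplus>\<^bsub>S\<^esub> g)) x = (h \<otimes>\<^bsub>S\<^esub> f \<oplus>\<^bsub>S\<^esub> h \<otimes>\<^bsub>S\<^esub> g) x" using x by simp
qed auto

lemma mult_zero: "f \<in> carrier S \<Longrightarrow> f \<otimes>\<^bsub>S\<^esub> \<zero>\<^bsub>S\<^esub> = \<zero>\<^bsub>S\<^esub>"
proof (rule extensionality)
  fix x assume f: "f \<in> carrier S" and x: "x \<in> carrier G"
  then have "(f \<otimes>\<^bsub>S\<^esub> \<zero>\<^bsub>S\<^esub>) x = (\<Oplus>\<^bsub>A\<^esub>y\<in>supp f. \<zero>\<^bsub>A\<^esub>)"
    unfolding mult_eq restrict_apply'[OF x] by (intro A.finsum_cong') auto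
  then show "(f \<otimes>\<^bsub>S\<^esub> \<zero>\<^bsub>S\<^esub>) x = \<zero>\<^bsub>S\<^esub> x" using x by simp
qed auto

lemma mono_mult_mono [simp]:
  assumes "a \<in> carrier A" "b \<in> carrier A" "g \<in> carrier G" "h \<in> carrier G"
  shows "mono a g \<otimes>\<^bsub>S\<^esub> mono b h = mono (a \<otimes>\<^bsub>A\<^esub> b) (g \<otimes>\<^bsub>G\<^esub> h)"
proof (rule extensionality)
  fix x assume x: "x \<in> carrier G"
  then have "inv\<^bsub>G\<^esub> g \<otimes>\<^bsub>G\<^esub> x = h \<longleftrightarrow> x = g \<otimes>\<^bsub>G\<^esub> h"
    using assms G.inv_solve_left[of h g x] by auto
  then show "(mono a g \<otimes>\<^bsub>S\<^esub> mono b h) x = mono (a \<otimes>\<^bsub>A\<^esub> b) (g \<otimes>\<^bsub>G\<^esub> h) x"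
    using assms x by simp
qed auto

lemma mult_assoc_mono:
  assumes a: "a \<in> carrier A" "g \<in> carrier G" and f: "f \<in> carrier S" and h: "h \<in> carrier S"
  shows "(mono a g \<otimes>\<^bsub>S\<^esub> f) \<otimes>\<^bsub>S\<^esub> h = mono a g \<otimes>\<^bsub>S\<^esub> (f \<otimes>\<^bsub>S\<^esub> h)"
  using f
proof (induction rule: group_ring_induct)
  case zero
  then show ?case using a h by (simp add: mult_zero zero_mult)
next
  case (mono b k)
  show ?case
    by (rule extensionality) (use a mono h in \<open>auto simp: A.m_assoc G.m_assoc G.inv_mult_group G.m_ac\<close>)
next
  case (add f f')
  then show ?case using a h by (simp add: mult_l_distr mult_r_distr)
qed

lemma cring_group_ring: "cring S"
proof (rule cringI)
  show "abelian_group S" by (rule abelian_group_group_ring)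
  show "comm_monoid S"
  proof (rule comm_monoidI)
    fix f g h assume f: "f \<in> carrier S" and g: "g \<in> carrier S" and h: "h \<in> carrier S"
    show "(f \<otimes>\<^bsub>S\<^esub> g) \<otimes>\<^bsub>S\<^esub> h = f \<otimes>\<^bsub>S\<^esub> (g \<otimes>\<^bsub>S\<^esub> h)"
      using f by (induction rule: group_ring_induct)
        (use g h in \<open>auto simp: mult_assoc_mono mult_l_distr zero_mult\<close>)
    have comm: "mono a x \<otimes>\<^bsub>S\<^esub> g = g \<otimes>\<^bsub>S\<^esub> mono a x" if "a \<in> carrier A" "x \<in> carrier G" for a x
      using g by (induction rule: group_ring_induct)
        (use that in \<open>auto simp: mult_l_distr mult_r_distr zero_mult mult_zero A.m_comm G.m_comm\<close>)
    show "f \<otimes>\<^bsub>S\<^esub> g = g \<otimes>\<^bsub>S\<^esub> f"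
      using f by (induction rule: group_ring_induct)
        (use g in \<open>auto simp: comm mult_l_distr mult_r_distr zero_mult mult_zero\<close>)
    show "\<one>\<^bsub>S\<^esub> \<otimes>\<^bsub>S\<^esub> f = f"
      unfolding one_eq by (rule extensionality) (use f in auto)
  qed (auto simp: one_eq)
qed (auto simp: mult_l_distr)

lemma one_not_zero_group_ring: "\<one>\<^bsub>S\<^esub> \<noteq> \<zero>\<^bsub>S\<^esub>"
  using one_not_zero zero_apply[of "\<one>\<^bsub>G\<^esub>"] mono_apply[of "\<one>\<^bsub>G\<^esub>" "\<one>\<^bsub>A\<^esub>" "\<one>\<^bsub>G\<^esub>"]
  unfolding one_eq by force

sublocale S: cring S by (rule cring_group_ring)

abbreviation const where "const a \<equiv> mono a \<one>\<^bsub>G\<^esub>"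
abbreviation elt where "elt g \<equiv> mono \<one>\<^bsub>A\<^esub> g"

lemma ring_hom_const: "ring_hom_cring A S const"
proof -
  have "const \<in> ring_hom A S"
    by (rule ring_hom_memI) (auto simp: one_eq intro!: extensionality)
  then show ?thesis
    by (intro ring_hom_cring.intro ring_hom_cring_axioms.intro A.cring_axioms cring_group_ring)
qed

lemma minus_apply [simp]:
  assumes "f \<in> carrier S" "g \<in> carrier S" "x \<in> carrier G"
  shows "(f \<ominus>\<^bsub>S\<^esub> g) x = f x \<ominus>\<^bsub>A\<^esub> g x"
proof -
  have "(f \<ominus>\<^bsub>S\<^esub> g) x \<oplus>\<^bsub>A\<^esub> g x = ((f \<ominus>\<^bsub>S\<^esub> g) \<oplus>\<^bsub>S\<^esub> g) x" using assms by simp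
  also have "(f \<ominus>\<^bsub>S\<^esub> g) \<oplus>\<^bsub>S\<^esub> g = f" using assms(1,2) by algebra
  finally have *: "(f \<ominus>\<^bsub>S\<^esub> g) x \<oplus>\<^bsub>A\<^esub> g x = f x" .
  have "(f \<ominus>\<^bsub>S\<^esub> g) x \<in> carrier A" using assms by auto
  then have "(f \<ominus>\<^bsub>S\<^esub> g) x = ((f \<ominus>\<^bsub>S\<^esub> g) x \<oplus>\<^bsub>A\<^esub> g x) \<ominus>\<^bsub>A\<^esub> g x"
    using assms value_closed[OF assms(2,3)] by algebra
  then show ?thesis unfolding * .
qed

lemma elt_pow: "g \<in> carrier G \<Longrightarrow> elt g [^]\<^bsub>S\<^esub> (n::nat) = elt (g [^]\<^bsub>G\<^esub> n)"
  by (induction n) (auto simp: one_eq)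

lemma const_mult_elt: "a \<in> carrier A \<Longrightarrow> g \<in> carrier G \<Longrightarrow> const a \<otimes>\<^bsub>S\<^esub> elt g = mono a g"
  by simp

sublocale const: ring_hom_cring A S const by (rule ring_hom_const)

text \<open>
  As simplification rules, \<open>hom_one\<close> and \<open>hom_mult\<close> would undo the evaluation of
  \<open>\<one>\<^bsub>S\<^esub>\<close> and of products of monomials.
\<close>

declare const.hom_one [simp del] const.hom_mult [simp del]

lemma const_nat: "const ([(n::nat)] \<cdot>\<^bsub>A\<^esub> \<one>\<^bsub>A\<^esub>) = [n] \<cdot>\<^bsub>S\<^esub> \<one>\<^bsub>S\<^esub>"
  by (induction n) (auto simp: const.hom_one)

end

section \<open>Sufficient conditions for a semi-local group ring\<close>

context comm_group_ring begin

lemma supported_in_span: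
  assumes J: "ideal J S" and "f \<in> carrier S" "set gs \<subseteq> carrier G" "supp f \<subseteq> set gs"
  shows "f \<in> mod_span S const (carrier A) J (map elt gs)"
  using assms(2-)
proof (induction gs arbitrary: f)
  case Nil
  then have "f = \<zero>\<^bsub>S\<^esub>" by (intro extensionality) auto
  then show ?case using S.ideal_closed(2)[OF J] by simp
next
  case (Cons g gs)
  let ?h = "\<lambda>x\<in>carrier G. if x = g then \<zero>\<^bsub>A\<^esub> else f x"
  have g: "g \<in> carrier G" using Cons.prems by auto
  have h: "?h \<in> carrier S"
    by (rule carrierI[of _ "set gs"]) (use Cons in \<open>auto split: if_splits\<close>)
  have "f = ?h \<oplus>\<^bsub>S\<^esub> const (f g) \<otimes>\<^bsub>S\<^esub> elt g"
    by (rule extensionality) (use Cons.prems g in auto)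
  moreover have "?h \<in> mod_span S const (carrier A) J (map elt gs)"
    by (rule Cons.IH[OF h]) (use Cons.prems in \<open>auto split: if_splits\<close>)
  moreover have "f g \<in> carrier A" using Cons.prems g by auto
  ultimately show ?case unfolding list.map mod_span.simps by blast
qed

lemma mult_supported:
  assumes "subgroup H G" "f \<in> carrier S" "g \<in> carrier S" "supp f \<subseteq> H" "supp g \<subseteq> H"
  shows "supp (f \<otimes>\<^bsub>S\<^esub> g) \<subseteq> H"
proof
  fix x assume x: "x \<in> supp (f \<otimes>\<^bsub>S\<^esub> g)"
  interpret H: subgroup H G by fact
  show "x \<in> H"
  proof (rule ccontr)
    assume xH: "x \<notin> H"
    have xc: "x \<in> carrier G" using x by blast
    have "g (inv\<^bsub>G\<^esub> y \<otimes>\<^bsub>G\<^esub> x) = \<zero>\<^bsub>A\<^esub>" if "y \<in> supp f" for y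
    proof (rule ccontr)
      assume "g (inv\<^bsub>G\<^esub> y \<otimes>\<^bsub>G\<^esub> x) \<noteq> \<zero>\<^bsub>A\<^esub>"
      then have "inv\<^bsub>G\<^esub> y \<otimes>\<^bsub>G\<^esub> x \<in> H" "y \<in> H" using that xc assms by auto
      then have "y \<otimes>\<^bsub>G\<^esub> (inv\<^bsub>G\<^esub> y \<otimes>\<^bsub>G\<^esub> x) \<in> H" by blast
      then show False using xH xc that by (simp add: G.m_assoc[symmetric])
    qed
    then have "(f \<otimes>\<^bsub>S\<^esub> g) x = (\<Oplus>\<^bsub>A\<^esub>y\<in>supp f. \<zero>\<^bsub>A\<^esub>)"
      unfolding mult_eq restrict_apply'[OF xc] using assms(2) by (intro A.finsum_cong') auto
    then show False using x by simp
  qed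
qed

text \<open>
  In a torsion group, the support of \<open>s\<close> generates a finite subgroup \<open>H\<close>, and \<open>A[H]\<close> is a finitely
  generated module stable under \<open>s\<close>.
\<close>

lemma maximalideal_contraction:
  assumes tors: "\<And>x. x \<in> carrier G \<Longrightarrow> G.ord x \<noteq> 0" and N: "maximalideal N S"
  shows "maximalideal {a \<in> carrier A. const a \<in> N} A"
proof (rule const.maximalideal_vimage[OF N])
  fix s assume s: "s \<in> carrier S"
  obtain H where H: "subgroup H G" "finite H" "supp s \<subseteq> H"
    using G.finite_subset_finite_subgroup[OF tors finite_supp[OF s]] by auto
  interpret H: subgroup H G by fact
  obtain gs where gs: "set gs = H" using finite_list H(2) by blast
  let ?Y = "{f \<in> carrier S. supp f \<subseteq> H}"
  have "?Y \<subseteq> mod_span S const (carrier A) N (map elt gs)"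
    using supported_in_span[OF S.maximalideal_ideal[OF N]] gs H.subset by auto
  moreover have "\<one>\<^bsub>S\<^esub> \<in> ?Y" "set (map elt gs) \<subseteq> ?Y"
    using gs by (auto simp: one_eq split: if_splits)
  moreover have "\<forall>f\<in>?Y. s \<otimes>\<^bsub>S\<^esub> f \<in> ?Y" using mult_supported[OF H(1) s _ H(3)] s by auto
  ultimately show "\<exists>Y es. Y \<subseteq> carrier S \<and> \<one>\<^bsub>S\<^esub> \<in> Y \<and> (\<forall>f\<in>Y. s \<otimes>\<^bsub>S\<^esub> f \<in> Y) \<and>
      set es \<subseteq> Y \<and> Y \<subseteq> mod_span S const (carrier A) N es"
    by (intro exI[of _ ?Y] exI[of _ "map elt gs"]) auto
qed

text \<open>
  The maximal ideals of \<open>S\<close> are sorted by their contractions to \<open>A\<close>, of which there are finitely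
  many. In each fibre, replacing \<open>elt g\<close> by the representative \<open>elt y\<close> changes an element of
  \<open>S\<close> only within the intersection of the fibre, so that \<open>Y\<close> spans \<open>S\<close> modulo this intersection.
\<close>

lemma semilocal_group_ringI:
  assumes A: "semilocal_ring A" and tors: "\<And>x. x \<in> carrier G \<Longrightarrow> G.ord x \<noteq> 0"
    and Y: "finite Y" "Y \<subseteq> carrier G"
    and rep: "\<And>g. g \<in> carrier G \<Longrightarrow> \<exists>y\<in>Y. \<forall>N. maximalideal N S \<longrightarrow> elt g \<ominus>\<^bsub>S\<^esub> elt y \<in> N"
  shows "semilocal_ring S"
proof -
  obtain ys where ys: "set ys = Y" using finite_list Y(1) by blast
  define Above where "Above m = {N. maximalideal N S \<and> (\<forall>a\<in>m. const a \<in> N)}" for m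
  have "finite (Above m)" if m: "maximalideal m A" for m
  proof (rule const.finite_maximalideals_over[OF m])
    let ?J = "{f \<in> carrier S. \<forall>N\<in>Above m. f \<in> N}"
    have J: "ideal ?J S" by (rule S.ideal_Inter_maximalideals) (auto simp: Above_def)
    show es: "set (map elt ys) \<subseteq> carrier S" using ys by auto
    show "carrier S \<subseteq> mod_span S const (carrier A) ?J (map elt ys)" (is "_ \<subseteq> ?W")
    proof
      fix f assume "f \<in> carrier S"
      then show "f \<in> ?W"
      proof (induction rule: group_ring_induct)
        case zero
        then show ?case
          using const.mod_span_base[OF J A.oneideal es] S.ideal_closed(2)[OF J] by blast
      next
        case (mono a g)
        obtain y where y: "y \<in> Y" "\<And>N. maximalideal N S \<Longrightarrow> elt g \<ominus>\<^bsub>S\<^esub> elt y \<in> N"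
          using rep[OF mono(2)] by blast
        have "elt y \<in> ?W" using const.mod_span_generator[OF J es] y(1) ys by auto
        then have 1: "const a \<otimes>\<^bsub>S\<^esub> elt y \<in> ?W"
          using const.mod_span_smult[OF J _ es mono(1), of "carrier A" "carrier A"] mono(1) by simp
        have "elt g \<ominus>\<^bsub>S\<^esub> elt y \<in> ?J" using y(2) by (auto simp: Above_def)
        then have "const a \<otimes>\<^bsub>S\<^esub> (elt g \<ominus>\<^bsub>S\<^esub> elt y) \<in> ?J"
          using S.ideal_closed(6)[OF J] mono(1) by blast
        then have 2: "const a \<otimes>\<^bsub>S\<^esub> (elt g \<ominus>\<^bsub>S\<^esub> elt y) \<in> ?W"
          using const.mod_span_base[OF J A.oneideal es] by blast
        have c: "const a \<in> carrier S" "elt g \<in> carrier S" "elt y \<in> carrier S" using mono by auto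
        then have "const a \<otimes>\<^bsub>S\<^esub> elt y \<oplus>\<^bsub>S\<^esub> const a \<otimes>\<^bsub>S\<^esub> (elt g \<ominus>\<^bsub>S\<^esub> elt y) = const a \<otimes>\<^bsub>S\<^esub> elt g"
          by algebra
        then show ?case
          using const.mod_span_add[OF J A.oneideal es 1 2] const_mult_elt[OF mono] by simp
      next
        case (add f g)
        then show ?case using const.mod_span_add[OF J A.oneideal es] by blast
      qed
    qed
  qed (auto simp: Above_def)
  then have "finite (\<Union>m\<in>{m. maximalideal m A}. Above m)"
    using A by (auto simp: semilocal_ring_def)
  moreover have "{N. maximalideal N S} \<subseteq> (\<Union>m\<in>{m. maximalideal m A}. Above m)"
    using maximalideal_contraction[OF tors] by (force simp: Above_def)
  ultimately have "finite {N. maximalideal N S}" by (rule rev_finite_subset)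
  then show ?thesis
    using cring_group_ring one_not_zero_group_ring by (simp add: semilocal_ring_def)
qed

text \<open>
  By the Frobenius congruence, \<open>g\<^sup>p\<close> can be congruent to \<open>1\<close> modulo \<open>N\<close> only if \<open>g\<close> is; this is
  applied \<open>k\<close> times.
\<close>

lemma elt_minus_one_in_maximalideal:
  assumes N: "maximalideal N S" and p: "Factorial_Ring.prime p" "[(p::nat)] \<cdot>\<^bsub>S\<^esub> \<one>\<^bsub>S\<^esub> \<in> N"
    and "g \<in> carrier G" "g [^]\<^bsub>G\<^esub> (p ^ k) = \<one>\<^bsub>G\<^esub>"
  shows "elt g \<ominus>\<^bsub>S\<^esub> \<one>\<^bsub>S\<^esub> \<in> N"
  using assms(4-)
proof (induction k arbitrary: g)
  case 0
  then have "elt g = \<one>\<^bsub>S\<^esub>" by (simp add: one_eq)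
  moreover have "\<one>\<^bsub>S\<^esub> \<ominus>\<^bsub>S\<^esub> \<one>\<^bsub>S\<^esub> = \<zero>\<^bsub>S\<^esub>" by (simp add: S.r_neg a_minus_def)
  ultimately show ?case using S.ideal_closed(2)[OF S.maximalideal_ideal[OF N]] by (simp only:)
next
  case (Suc k)
  have "(g [^]\<^bsub>G\<^esub> p) [^]\<^bsub>G\<^esub> (p ^ k) = \<one>\<^bsub>G\<^esub>" using Suc.prems by (simp add: G.nat_pow_pow)
  then have IH: "elt (g [^]\<^bsub>G\<^esub> p) \<ominus>\<^bsub>S\<^esub> \<one>\<^bsub>S\<^esub> \<in> N" using Suc by simp
  have e: "elt g \<in> carrier S" using Suc.prems by auto
  have "\<one>\<^bsub>S\<^esub> \<oplus>\<^bsub>S\<^esub> (elt g \<ominus>\<^bsub>S\<^esub> \<one>\<^bsub>S\<^esub>) = elt g" using e by algebra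
  then have "(\<one>\<^bsub>S\<^esub> \<oplus>\<^bsub>S\<^esub> (elt g \<ominus>\<^bsub>S\<^esub> \<one>\<^bsub>S\<^esub>)) [^]\<^bsub>S\<^esub> p \<ominus>\<^bsub>S\<^esub> \<one>\<^bsub>S\<^esub> \<in> N"
    using IH elt_pow[OF Suc.prems(1), of p] by (simp only:)
  moreover have "elt g \<ominus>\<^bsub>S\<^esub> \<one>\<^bsub>S\<^esub> \<in> carrier S" using e by (rule S.minus_closed) simp
  ultimately show ?case by (rule S.maximalideal_frobenius[OF N p, rotated])
qed

lemma semilocal_if_finite:
  assumes "semilocal_ring A" "finite (carrier G)"
  shows "semilocal_ring S"
proof (rule semilocal_group_ringI[OF assms(1) _ assms(2)])
  show "G.ord x \<noteq> 0" if "x \<in> carrier G" for x using G.ord_ge_1[OF assms(2) that] by simp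
  show "\<exists>y\<in>carrier G. \<forall>N. maximalideal N S \<longrightarrow> elt g \<ominus>\<^bsub>S\<^esub> elt y \<in> N" if "g \<in> carrier G" for g
    using that S.ideal_closed(2)[OF S.maximalideal_ideal]
    by (intro bexI[of _ g]) (auto simp: S.r_neg a_minus_def)
qed simp

lemma semilocal_if_p_group_by_finite:
  assumes A: "semilocal_ring A" and p: "Factorial_Ring.prime p"
    and char: "ring_characteristic (A Quot jacobson_radical A) = p"
    and dp: "internal_direct_product G G\<^sub>p G\<^sub>0" and Gp: "p_group p (G\<lparr>carrier := G\<^sub>p\<rparr>)" and G0: "finite G\<^sub>0"
  shows "semilocal_ring S"
proof -
  have sp: "subgroup G\<^sub>p G" "subgroup G\<^sub>0 G" and prod: "G\<^sub>p <#>\<^bsub>G\<^esub> G\<^sub>0 = carrier G"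
    using dp normal_imp_subgroup by (auto simp: internal_direct_product_def)
  have ordp: "\<exists>k. G.ord x = p ^ k" if "x \<in> G\<^sub>p" for x
  proof -
    have "\<exists>k. group.ord (G\<lparr>carrier := G\<^sub>p\<rparr>) x = p ^ k"
      using Gp that unfolding p_group_def by simp
    then show ?thesis unfolding G.ord_in_subgroup[OF sp(1) that] .
  qed
  have ord0: "G.ord y \<noteq> 0" if "y \<in> G\<^sub>0" for y
    using group.ord_ge_1[OF G.subgroup_imp_group[OF sp(2)], of y] that G0
      G.ord_in_subgroup[OF sp(2) that] by auto
  have G0c: "G\<^sub>0 \<subseteq> carrier G" and Gpc: "G\<^sub>p \<subseteq> carrier G" using sp subgroup.subset by auto
  have dec: "\<exists>x\<in>G\<^sub>p. \<exists>y\<in>G\<^sub>0. g = x \<otimes>\<^bsub>G\<^esub> y" if "g \<in> carrier G" for g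
    using that unfolding prod[symmetric] set_mult_def by blast
  have tors: "G.ord g \<noteq> 0" if g: "g \<in> carrier G" for g
  proof -
    obtain x y where xy: "x \<in> G\<^sub>p" "y \<in> G\<^sub>0" "g = x \<otimes>\<^bsub>G\<^esub> y" using dec[OF g] by blast
    have "G.ord x * G.ord y \<noteq> 0" using ordp[OF xy(1)] ord0[OF xy(2)] prime_gt_0_nat[OF p] by auto
    then show ?thesis
      using G.abelian_ord_mul_divides[of x y] xy G0c Gpc by (metis dvd_0_left subsetD)
  qed
  have pR: "[p] \<cdot>\<^bsub>A\<^esub> \<one>\<^bsub>A\<^esub> \<in> jacobson_radical A"
    using A.ring_characteristic_Quot_dvd[OF A.ideal_jacobson_radical, of p] char by simp
  show ?thesis
  proof (rule semilocal_group_ringI[OF A tors G0 G0c])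
    fix g assume g: "g \<in> carrier G"
    obtain x y where xy: "x \<in> G\<^sub>p" "y \<in> G\<^sub>0" "g = x \<otimes>\<^bsub>G\<^esub> y" using dec[OF g] by blast
    have c: "x \<in> carrier G" "y \<in> carrier G" using xy G0c Gpc by auto
    have "elt g \<ominus>\<^bsub>S\<^esub> elt y \<in> N" if N: "maximalideal N S" for N
    proof -
      have "[p] \<cdot>\<^bsub>A\<^esub> \<one>\<^bsub>A\<^esub> \<in> {a \<in> carrier A. const a \<in> N}"
        using pR maximalideal_contraction[OF tors N] unfolding jacobson_radical_def by blast
      then have "[p] \<cdot>\<^bsub>S\<^esub> \<one>\<^bsub>S\<^esub> \<in> N" using const_nat[of p] by simp
      moreover obtain k where "G.ord x = p ^ k" using ordp xy by blast
      then have "x [^]\<^bsub>G\<^esub> (p ^ k) = \<one>\<^bsub>G\<^esub>" using G.pow_ord_eq_1[OF c(1)] by simp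
      ultimately have "elt x \<ominus>\<^bsub>S\<^esub> \<one>\<^bsub>S\<^esub> \<in> N"
        using elt_minus_one_in_maximalideal[OF N p _ c(1)] by blast
      then have "elt y \<otimes>\<^bsub>S\<^esub> (elt x \<ominus>\<^bsub>S\<^esub> \<one>\<^bsub>S\<^esub>) \<in> N"
        using S.ideal_closed(6)[OF S.maximalideal_ideal[OF N]] by auto
      moreover have "elt g = elt x \<otimes>\<^bsub>S\<^esub> elt y" using xy c by simp
      moreover have "elt y \<otimes>\<^bsub>S\<^esub> (e \<ominus>\<^bsub>S\<^esub> \<one>\<^bsub>S\<^esub>) = e \<otimes>\<^bsub>S\<^esub> elt y \<ominus>\<^bsub>S\<^esub> elt y" if "e \<in> carrier S" for e
      proof -
        have "elt y \<in> carrier S" by auto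
        then show ?thesis using that by algebra
      qed
      ultimately show ?thesis by simp
    qed
    then show "\<exists>y\<in>G\<^sub>0. \<forall>N. maximalideal N S \<longrightarrow> elt g \<ominus>\<^bsub>S\<^esub> elt y \<in> N" using xy by blast
  qed
qed

end

section \<open>Coefficients and torsion in the semi-local case\<close>

context comm_group_ring begin

lemma const_mult_apply:
  "a \<in> carrier A \<Longrightarrow> f \<in> carrier S \<Longrightarrow> x \<in> carrier G \<Longrightarrow> (const a \<otimes>\<^bsub>S\<^esub> f) x = a \<otimes>\<^bsub>A\<^esub> f x"
  by simp

text \<open>
  This is the extension \<open>mS\<close> of the ideal \<open>m\<close>, described coefficientwise.
\<close>

lemma ideal_extension:
  assumes m: "ideal m A"
  shows "ideal {f \<in> carrier S. \<forall>x\<in>carrier G. f x \<in> m} S" (is "ideal ?I S")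
proof -
  note I = A.ideal_closed[OF m]
  have mult: "g \<otimes>\<^bsub>S\<^esub> f \<in> ?I" if f: "f \<in> ?I" and g: "g \<in> carrier S" for f g
  proof -
    have "(g \<otimes>\<^bsub>S\<^esub> f) x \<in> m" if x: "x \<in> carrier G" for x
      unfolding mult_eq restrict_apply'[OF x]
      by (rule A.finsum_in_ideal[OF m]) (use f g x I(6) in auto)
    then show ?thesis using f g by auto
  qed
  show ?thesis
  proof (rule idealI)
    show "ring S" by (rule S.ring_axioms)
    show "subgroup ?I (add_monoid S)"
    proof (rule S.add.subgroupI)
      show "?I \<noteq> {}" using I(2) by (auto intro!: exI[of _ "\<zero>\<^bsub>S\<^esub>"])
      show "\<ominus>\<^bsub>S\<^esub> f \<in> ?I" if f: "f \<in> ?I" for f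
      proof -
        have "\<ominus>\<^bsub>S\<^esub> f = \<zero>\<^bsub>S\<^esub> \<ominus>\<^bsub>S\<^esub> f" using f by (simp add: a_minus_def)
        then have "(\<ominus>\<^bsub>S\<^esub> f) x = \<zero>\<^bsub>A\<^esub> \<ominus>\<^bsub>A\<^esub> f x" if "x \<in> carrier G" for x using f that by simp
        then show ?thesis using f I(2,5) by auto
      qed
    qed (use I in auto)
    show "g \<otimes>\<^bsub>S\<^esub> f \<in> ?I" if "f \<in> ?I" "g \<in> carrier S" for f g using mult that .
    show "f \<otimes>\<^bsub>S\<^esub> g \<in> ?I" if "f \<in> ?I" "g \<in> carrier S" for f g
      using mult[OF that] that S.m_comm[of f g] by auto
  qed
qed

text \<open>
  A maximal ideal \<open>m\<close> of \<open>A\<close> can be recovered from any maximal ideal of \<open>S\<close> that contains the proper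
  ideal \<open>mS\<close>, as its contraction to \<open>A\<close>.
\<close>

lemma semilocal_coefficients:
  assumes S: "semilocal_ring S"
  shows "semilocal_ring A"
proof -
  have "\<exists>N. maximalideal N S \<and> {a \<in> carrier A. const a \<in> N} = m" if m: "maximalideal m A" for m
  proof -
    note mi = A.maximalideal_ideal[OF m]
    let ?I = "{f \<in> carrier S. \<forall>x\<in>carrier G. f x \<in> m}"
    have "\<one>\<^bsub>S\<^esub> \<notin> ?I" using A.one_notin_maximalideal[OF m] by (auto simp: one_eq)
    then obtain N where N: "maximalideal N S" "?I \<subseteq> N"
      using S.ideal_subset_maximalideal[OF ideal_extension[OF mi]] by blast
    have "const a \<in> ?I" if "a \<in> m" for a
      using that A.ideal_closed(1,2)[OF mi] by auto
    then have "m \<subseteq> {a \<in> carrier A. const a \<in> N}" using N(2) A.ideal_closed(1)[OF mi] by blast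
    moreover have "\<one>\<^bsub>A\<^esub> \<notin> {a \<in> carrier A. const a \<in> N}"
      using S.one_notin_maximalideal[OF N(1)] by (simp add: one_eq)
    ultimately show ?thesis
      using N(1) A.maximalideal_eq[OF m const.ideal_vimage[OF S.maximalideal_ideal[OF N(1)]]] by blast
  qed
  then have "{m. maximalideal m A} \<subseteq> (\<lambda>N. {a \<in> carrier A. const a \<in> N}) ` {N. maximalideal N S}"
    by blast
  then have "finite {m. maximalideal m A}"
    using S by (auto simp: semilocal_ring_def intro: finite_surj)
  then show ?thesis using A.is_cring one_not_zero by (simp add: semilocal_ring_def)
qed

text \<open>
  A function of finite support cannot be constant and non-zero on the infinite set of all
  \<open>y u\<^sup>n\<close>.
\<close>

lemma invariant_translate_zero:
  assumes t: "t \<in> carrier S" and u: "u \<in> carrier G" "G.ord u = 0" and y: "y \<in> carrier G"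
    and inv: "\<And>n::nat. t (y \<otimes>\<^bsub>G\<^esub> u [^]\<^bsub>G\<^esub> Suc n) = t (y \<otimes>\<^bsub>G\<^esub> u [^]\<^bsub>G\<^esub> n)"
  shows "t y = \<zero>\<^bsub>A\<^esub>"
proof (rule ccontr)
  assume ne: "t y \<noteq> \<zero>\<^bsub>A\<^esub>"
  have eq: "t (y \<otimes>\<^bsub>G\<^esub> u [^]\<^bsub>G\<^esub> (n::nat)) = t y" for n
  proof (induction n)
    case (Suc n)
    then show ?case using inv[of n] by (simp only:)
  qed (use y in simp)
  then have "range (\<lambda>n::nat. y \<otimes>\<^bsub>G\<^esub> u [^]\<^bsub>G\<^esub> n) \<subseteq> supp t" using ne y u by auto
  then have "finite (range (\<lambda>n::nat. y \<otimes>\<^bsub>G\<^esub> u [^]\<^bsub>G\<^esub> n))"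
    using finite_supp[OF t] finite_subset by blast
  moreover have "inj (\<lambda>n::nat. y \<otimes>\<^bsub>G\<^esub> u [^]\<^bsub>G\<^esub> n)"
    using G.pow_inj_infinite_order[OF u] y u by (auto intro!: injI)
  ultimately show False using finite_imageD infinite_UNIV_nat by blast
qed

text \<open>
  An inverse \<open>t\<close> would satisfy \<open>(u - 1) t = x - 1\<close> with \<open>u = x\<^sup>q\<close>. On the powers of \<open>u\<close> this says that the
  coefficients of \<open>t\<close> are constant on \<open>u\<^sup>n\<close> for \<open>n \<ge> 0\<close> and for \<open>n < 0\<close>, hence zero by finiteness
  of the support, but that they jump by \<open>1\<close> between \<open>u\<^sup>-\<^sup>1\<close> and \<open>u\<^sup>0\<close>.
\<close>

lemma geometric_sum_nonunit:
  assumes x: "x \<in> carrier G" "G.ord x = 0" and q: "q \<ge> 2"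
  shows "geometric_sum S (elt x) q \<notin> Units S"
proof
  let ?g = "geometric_sum S (elt x) q"
  assume "?g \<in> Units S"
  then obtain t where t: "t \<in> carrier S" "?g \<otimes>\<^bsub>S\<^esub> t = \<one>\<^bsub>S\<^esub>" by (auto simp: Units_def)
  define u where "u = x [^]\<^bsub>G\<^esub> q"
  have u: "u \<in> carrier G" using x by (simp add: u_def)
  note pow = G.pow_inj_infinite_order[OF x]
  have upow: "u [^]\<^bsub>G\<^esub> n = x [^]\<^bsub>G\<^esub> (q * n)" for n :: nat
    using x by (simp add: u_def G.nat_pow_pow)
  have u0: "G.ord u = 0"
  proof -
    have "u [^]\<^bsub>G\<^esub> n \<noteq> \<one>\<^bsub>G\<^esub>" if "n \<noteq> 0" for n :: nat
      using pow[of "q * n" 0] that q unfolding upow by simp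
    then show ?thesis using G.ord_eq_0[OF u] by blast
  qed
  have e: "elt x \<in> carrier S" and g: "?g \<in> carrier S" by auto
  have "(elt u \<ominus>\<^bsub>S\<^esub> \<one>\<^bsub>S\<^esub>) \<otimes>\<^bsub>S\<^esub> t = ((elt x \<ominus>\<^bsub>S\<^esub> \<one>\<^bsub>S\<^esub>) \<otimes>\<^bsub>S\<^esub> ?g) \<otimes>\<^bsub>S\<^esub> t"
    using S.geometric_sum_telescope[OF e] elt_pow[OF x(1)] by (simp add: u_def)
  also have "\<dots> = (elt x \<ominus>\<^bsub>S\<^esub> \<one>\<^bsub>S\<^esub>) \<otimes>\<^bsub>S\<^esub> (?g \<otimes>\<^bsub>S\<^esub> t)"
    using e g t(1) by (simp add: S.m_assoc)
  also have "\<dots> = elt x \<ominus>\<^bsub>S\<^esub> \<one>\<^bsub>S\<^esub>" using e t(2) by simp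
  finally have "(elt u \<ominus>\<^bsub>S\<^esub> \<one>\<^bsub>S\<^esub>) \<otimes>\<^bsub>S\<^esub> t = elt x \<ominus>\<^bsub>S\<^esub> \<one>\<^bsub>S\<^esub>" .
  moreover have "(elt u \<ominus>\<^bsub>S\<^esub> \<one>\<^bsub>S\<^esub>) \<otimes>\<^bsub>S\<^esub> t = elt u \<otimes>\<^bsub>S\<^esub> t \<ominus>\<^bsub>S\<^esub> t"
  proof -
    have "elt u \<in> carrier S" by auto
    then show ?thesis using t(1) by algebra
  qed
  ultimately have eq: "elt u \<otimes>\<^bsub>S\<^esub> t \<ominus>\<^bsub>S\<^esub> t = elt x \<ominus>\<^bsub>S\<^esub> \<one>\<^bsub>S\<^esub>" by simp
  have step: "t (inv\<^bsub>G\<^esub> u \<otimes>\<^bsub>G\<^esub> z) \<ominus>\<^bsub>A\<^esub> t z =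
      (if z = x then \<one>\<^bsub>A\<^esub> else \<zero>\<^bsub>A\<^esub>) \<ominus>\<^bsub>A\<^esub> (if z = \<one>\<^bsub>G\<^esub> then \<one>\<^bsub>A\<^esub> else \<zero>\<^bsub>A\<^esub>)"
    if z: "z \<in> carrier G" for z
    using arg_cong[OF eq, of "\<lambda>f. f z"] z u t(1) by (simp add: one_eq)
  have step': "t (inv\<^bsub>G\<^esub> u \<otimes>\<^bsub>G\<^esub> z) = t z" if z: "z \<in> carrier G" "z \<noteq> x" "z \<noteq> \<one>\<^bsub>G\<^esub>" for z
  proof -
    have "t (inv\<^bsub>G\<^esub> u \<otimes>\<^bsub>G\<^esub> z) \<ominus>\<^bsub>A\<^esub> t z = \<zero>\<^bsub>A\<^esub>" using step[OF z(1)] z by (simp add: a_minus_def)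
    then show ?thesis using t(1) z u by simp
  qed
  have 1: "t \<one>\<^bsub>G\<^esub> = \<zero>\<^bsub>A\<^esub>"
  proof (rule invariant_translate_zero[OF t(1) u u0])
    fix n :: nat
    let ?z = "u [^]\<^bsub>G\<^esub> Suc n"
    have "?z \<noteq> x" "?z \<noteq> \<one>\<^bsub>G\<^esub>"
      using pow[of "q * Suc n" 1] pow[of "q * Suc n" 0] q x(1) unfolding upow by auto
    moreover have "inv\<^bsub>G\<^esub> u \<otimes>\<^bsub>G\<^esub> ?z = u [^]\<^bsub>G\<^esub> n"
      using u by (simp add: G.m_comm[of _ u] G.m_assoc[symmetric])
    moreover have "?z \<in> carrier G" using u by (rule G.nat_pow_closed)
    ultimately have "t ?z = t (u [^]\<^bsub>G\<^esub> n)" using step'[of ?z] by metis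
    then show "t (\<one>\<^bsub>G\<^esub> \<otimes>\<^bsub>G\<^esub> ?z) = t (\<one>\<^bsub>G\<^esub> \<otimes>\<^bsub>G\<^esub> u [^]\<^bsub>G\<^esub> n)"
      using G.nat_pow_closed[OF u] by (simp only: G.l_one)
  qed simp
  \<comment> \<open>The coefficients on the negative powers of \<open>u\<close> are those on \<open>u\<^sup>-\<^sup>1 (u\<^sup>-\<^sup>1)\<^sup>n\<close> for \<open>n \<ge> 0\<close>.\<close>
  have 2: "t (inv\<^bsub>G\<^esub> u) = \<zero>\<^bsub>A\<^esub>"
  proof (rule invariant_translate_zero[OF t(1) G.inv_closed[OF u]])
    show "G.ord (inv\<^bsub>G\<^esub> u) = 0" using u u0 by simp
    fix n :: nat
    let ?z = "inv\<^bsub>G\<^esub> u \<otimes>\<^bsub>G\<^esub> inv\<^bsub>G\<^esub> u [^]\<^bsub>G\<^esub> n"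
    have zc: "?z \<in> carrier G" using u by simp
    have z: "?z = inv\<^bsub>G\<^esub> (x [^]\<^bsub>G\<^esub> (q * Suc n))"
      using u unfolding upow[symmetric] by (simp add: G.nat_pow_inv G.inv_mult_group)
    have "?z \<noteq> \<one>\<^bsub>G\<^esub>"
      using pow[of "q * Suc n" 0] q x(1) unfolding z by (simp add: G.inv_eq_1_iff)
    moreover have "?z \<noteq> x"
    proof
      assume "?z = x"
      then have "x \<otimes>\<^bsub>G\<^esub> x [^]\<^bsub>G\<^esub> (q * Suc n) = \<one>\<^bsub>G\<^esub>"
        unfolding z using x(1) by (metis G.l_inv G.nat_pow_closed)
      then have "x [^]\<^bsub>G\<^esub> Suc (q * Suc n) = x [^]\<^bsub>G\<^esub> (0::nat)"
        using x(1) by (simp add: G.m_comm)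
      then show False using pow by blast
    qed
    ultimately have "t (inv\<^bsub>G\<^esub> u \<otimes>\<^bsub>G\<^esub> ?z) = t ?z" using step' zc by blast
    moreover have "inv\<^bsub>G\<^esub> u \<otimes>\<^bsub>G\<^esub> ?z = inv\<^bsub>G\<^esub> u \<otimes>\<^bsub>G\<^esub> inv\<^bsub>G\<^esub> u [^]\<^bsub>G\<^esub> Suc n"
      using u by (simp add: G.m_comm)
    ultimately show "t (inv\<^bsub>G\<^esub> u \<otimes>\<^bsub>G\<^esub> inv\<^bsub>G\<^esub> u [^]\<^bsub>G\<^esub> Suc n) = t ?z" by (simp only:)
  qed (use u in simp)
  have "x \<noteq> \<one>\<^bsub>G\<^esub>" using x by auto
  then have "\<zero>\<^bsub>A\<^esub> \<ominus>\<^bsub>A\<^esub> \<one>\<^bsub>A\<^esub> = \<zero>\<^bsub>A\<^esub>" using step[of "\<one>\<^bsub>G\<^esub>"] 1 2 u by (simp add: a_minus_def)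
  then show False using one_not_zero by simp
qed

lemma semilocal_imp_torsion:
  assumes S: "semilocal_ring S" and x: "x \<in> carrier G"
  shows "G.ord x \<noteq> 0"
proof
  assume x0: "G.ord x = 0"
  let ?g = "geometric_sum S (elt x)"
  have e: "elt x \<in> carrier S" by auto
  have "\<exists>N. maximalideal N S \<and> ?g q \<in> N" if "Factorial_Ring.prime q" for q :: nat
    using S.nonunit_in_maximalideal[OF S.geometric_sum_closed[OF e]]
      geometric_sum_nonunit[OF x x0 prime_ge_2_nat[OF that]] by blast
  then obtain N where N: "\<And>q::nat. Factorial_Ring.prime q \<Longrightarrow> maximalideal (N q) S \<and> ?g q \<in> N q"
    by metis
  have "inj_on N {q. Factorial_Ring.prime q}"
  proof (rule inj_onI, rule ccontr)
    fix p q :: nat assume pq: "p \<in> {q. Factorial_Ring.prime q}" "q \<in> {q. Factorial_Ring.prime q}" "N p = N q" "p \<noteq> q"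
    then have p: "maximalideal (N p) S" "?g p \<in> N p" "?g q \<in> N p" using N by auto
    have "coprime p q" using pq primes_coprime by auto
    then have "\<one>\<^bsub>S\<^esub> \<in> N p"
      using S.geometric_sum_coprime[OF e S.maximalideal_ideal[OF p(1)] p(2,3)] pq(1) prime_gt_0_nat
      by force
    then show False using S.one_notin_maximalideal[OF p(1)] by blast
  qed
  moreover have "N ` {q. Factorial_Ring.prime q} \<subseteq> {M. maximalideal M S}" using N by auto
  ultimately have "finite {q::nat. Factorial_Ring.prime q}"
    using S finite_imageD finite_subset unfolding semilocal_ring_def by metis
  then show False using primes_infinite by simp
qed

end

section \<open>Chains of finite subgroups\<close>

context comm_group_ring begin

definition subgroup_sum :: "'g set \<Rightarrow> 'g \<Rightarrow> 'a"
  where "subgroup_sum F = (\<lambda>x\<in>carrier G. if x \<in> F then \<one>\<^bsub>A\<^esub> else \<zero>\<^bsub>A\<^esub>)"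

abbreviation const_card :: "'g set \<Rightarrow> 'g \<Rightarrow> 'a"
  where "const_card F \<equiv> const ([card F] \<cdot>\<^bsub>A\<^esub> \<one>\<^bsub>A\<^esub>)"

text \<open>
  For \<open>F \<subseteq> F'\<close> this is \<open>|F| |F'|\<close> times the difference of the averages of \<open>F'\<close> and \<open>F\<close>, which are
  idempotents where the orders are invertible. The multiple is defined over every ring \<open>A\<close>.
\<close>

definition subgroup_diff :: "'g set \<Rightarrow> 'g set \<Rightarrow> 'g \<Rightarrow> 'a"
  where "subgroup_diff F F' =
    const_card F \<otimes>\<^bsub>S\<^esub> subgroup_sum F' \<ominus>\<^bsub>S\<^esub> const_card F' \<otimes>\<^bsub>S\<^esub> subgroup_sum F"

lemma subgroup_sum_apply [simp]:
  "x \<in> carrier G \<Longrightarrow> subgroup_sum F x = (if x \<in> F then \<one>\<^bsub>A\<^esub> else \<zero>\<^bsub>A\<^esub>)"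
  by (simp add: subgroup_sum_def)

lemma subgroup_sum_closed [simp, intro]: "finite F \<Longrightarrow> subgroup_sum F \<in> carrier S"
  by (rule carrierI[of _ F]) (auto simp: subgroup_sum_def split: if_splits)

lemma const_card_closed: "const_card F \<in> carrier S"
  by auto

text \<open>
  Translation by an element of \<open>F\<close> preserves \<open>F'\<close>, so each of the \<open>|F|\<close> summands contributes the same
  function.
\<close>

lemma subgroup_sum_mult:
  assumes F: "subgroup F G" "finite F" and F': "subgroup F' G" "finite F'" and sub: "F \<subseteq> F'"
  shows "subgroup_sum F \<otimes>\<^bsub>S\<^esub> subgroup_sum F' = const_card F \<otimes>\<^bsub>S\<^esub> subgroup_sum F'"
proof (rule extensionality)
  fix x assume x: "x \<in> carrier G"
  interpret F: subgroup F G by fact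
  interpret F': subgroup F' G by fact
  let ?c = "subgroup_sum F' x"
  have c: "?c \<in> carrier A" using x F' by auto
  have inv: "subgroup_sum F' (inv\<^bsub>G\<^esub> y \<otimes>\<^bsub>G\<^esub> x) = ?c" if y: "y \<in> F" for y
  proof -
    have yF: "y \<in> F'" "y \<in> carrier G" using y sub by auto
    have "inv\<^bsub>G\<^esub> y \<otimes>\<^bsub>G\<^esub> x \<in> F' \<longleftrightarrow> x \<in> F'"
    proof
      assume "inv\<^bsub>G\<^esub> y \<otimes>\<^bsub>G\<^esub> x \<in> F'"
      then have "y \<otimes>\<^bsub>G\<^esub> (inv\<^bsub>G\<^esub> y \<otimes>\<^bsub>G\<^esub> x) \<in> F'" using yF by blast
      then show "x \<in> F'" using x yF by (simp add: G.m_assoc[symmetric])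
    qed (use yF in blast)
    then show ?thesis using x yF by simp
  qed
  have "(subgroup_sum F \<otimes>\<^bsub>S\<^esub> subgroup_sum F') x =
      (\<Oplus>\<^bsub>A\<^esub>y\<in>F. subgroup_sum F y \<otimes>\<^bsub>A\<^esub> subgroup_sum F' (inv\<^bsub>G\<^esub> y \<otimes>\<^bsub>G\<^esub> x))"
    by (rule mult_apply) (use F F' x in \<open>auto split: if_splits\<close>)
  also have "\<dots> = (\<Oplus>\<^bsub>A\<^esub>y\<in>F. ?c)"
    by (rule A.finsum_cong') (use c in \<open>auto simp: inv\<close>)
  also have "\<dots> = [card F] \<cdot>\<^bsub>A\<^esub> ?c" using A.add.finprod_const[OF c] .
  also have "\<dots> = (const_card F \<otimes>\<^bsub>S\<^esub> subgroup_sum F') x"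
    using x F' c by (subst const_mult_apply) (auto simp: A.add_pow_ldistr)
  finally show "(subgroup_sum F \<otimes>\<^bsub>S\<^esub> subgroup_sum F') x = (const_card F \<otimes>\<^bsub>S\<^esub> subgroup_sum F') x" .
qed auto

lemma subgroup_diff_closed [simp, intro]:
  "finite F \<Longrightarrow> finite F' \<Longrightarrow> subgroup_diff F F' \<in> carrier S"
  unfolding subgroup_diff_def by (intro S.minus_closed mult_closed const_card_closed subgroup_sum_closed)

lemma subgroup_diff_mult_sum:
  assumes F: "subgroup F G" "finite F" and F': "subgroup F' G" "finite F'" and sub: "F \<subseteq> F'"
    and E: "subgroup E G" "finite E" "F' \<subseteq> E"
  shows "subgroup_diff F F' \<otimes>\<^bsub>S\<^esub> subgroup_sum E = \<zero>\<^bsub>S\<^esub>"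
proof -
  let ?a = "const_card F" let ?b = "const_card F'"
  let ?s = "subgroup_sum F" let ?s' = "subgroup_sum F'" let ?t = "subgroup_sum E"
  have *: "(a \<otimes>\<^bsub>S\<^esub> s' \<ominus>\<^bsub>S\<^esub> b \<otimes>\<^bsub>S\<^esub> s) \<otimes>\<^bsub>S\<^esub> t = a \<otimes>\<^bsub>S\<^esub> (s' \<otimes>\<^bsub>S\<^esub> t) \<ominus>\<^bsub>S\<^esub> b \<otimes>\<^bsub>S\<^esub> (s \<otimes>\<^bsub>S\<^esub> t)"
    if "a \<in> carrier S" "b \<in> carrier S" "s \<in> carrier S" "s' \<in> carrier S" "t \<in> carrier S" for a b s s' t
    using that by algebra
  have **: "a \<otimes>\<^bsub>S\<^esub> (b \<otimes>\<^bsub>S\<^esub> t) \<ominus>\<^bsub>S\<^esub> b \<otimes>\<^bsub>S\<^esub> (a \<otimes>\<^bsub>S\<^esub> t) = \<zero>\<^bsub>S\<^esub>"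
    if "a \<in> carrier S" "b \<in> carrier S" "t \<in> carrier S" for a b t
    using that by algebra
  note c = const_card_closed subgroup_sum_closed
  have "F \<subseteq> E" using sub E by blast
  note prods = subgroup_sum_mult[OF F' E] subgroup_sum_mult[OF F E(1,2) this]
  show ?thesis
    unfolding subgroup_diff_def *[OF const_card_closed const_card_closed c(2)[OF F(2)] c(2)[OF F'(2)] c(2)[OF E(2)]]
      prods
    by (rule **) (use E in auto)
qed

lemma subgroup_diff_orthogonal:
  assumes F: "subgroup F G" "finite F" and F': "subgroup F' G" "finite F'" and sub: "F \<subseteq> F'"
    and E: "subgroup E G" "finite E" "F' \<subseteq> E" and E': "subgroup E' G" "finite E'" "E \<subseteq> E'"
  shows "subgroup_diff F F' \<otimes>\<^bsub>S\<^esub> subgroup_diff E E' = \<zero>\<^bsub>S\<^esub>"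
proof -
  have *: "d \<otimes>\<^bsub>S\<^esub> (a \<otimes>\<^bsub>S\<^esub> s' \<ominus>\<^bsub>S\<^esub> b \<otimes>\<^bsub>S\<^esub> s) = a \<otimes>\<^bsub>S\<^esub> (d \<otimes>\<^bsub>S\<^esub> s') \<ominus>\<^bsub>S\<^esub> b \<otimes>\<^bsub>S\<^esub> (d \<otimes>\<^bsub>S\<^esub> s)"
    if "a \<in> carrier S" "b \<in> carrier S" "s \<in> carrier S" "s' \<in> carrier S" "d \<in> carrier S" for a b s s' d
    using that by algebra
  have "F' \<subseteq> E'" using E E' by blast
  note prods = subgroup_diff_mult_sum[OF F F' sub E] subgroup_diff_mult_sum[OF F F' sub E'(1,2) this]
  have "subgroup_diff F F' \<otimes>\<^bsub>S\<^esub> subgroup_diff E E' =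
      const_card E \<otimes>\<^bsub>S\<^esub> \<zero>\<^bsub>S\<^esub> \<ominus>\<^bsub>S\<^esub> const_card E' \<otimes>\<^bsub>S\<^esub> \<zero>\<^bsub>S\<^esub>"
    unfolding subgroup_diff_def[of E E']
    by (subst *) (use F F' E E' prods in auto)
  then show ?thesis by (simp add: a_minus_def)
qed

text \<open>
  Up to the factor \<open>- |F| |F'|\<close>, the element \<open>subgroup_diff F F'\<close> is idempotent.
\<close>

lemma subgroup_diff_square:
  assumes F: "subgroup F G" "finite F" and F': "subgroup F' G" "finite F'" and sub: "F \<subseteq> F'"
  shows "subgroup_diff F F' \<otimes>\<^bsub>S\<^esub> subgroup_diff F F' =
    \<ominus>\<^bsub>S\<^esub> (const_card F \<otimes>\<^bsub>S\<^esub> const_card F' \<otimes>\<^bsub>S\<^esub> subgroup_diff F F')"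
proof -
  let ?d = "subgroup_diff F F'"
  let ?a = "const_card F" let ?b = "const_card F'"
  let ?s = "subgroup_sum F" let ?s' = "subgroup_sum F'"
  have c: "?a \<in> carrier S" "?b \<in> carrier S" "?s \<in> carrier S" "?s' \<in> carrier S" "?d \<in> carrier S"
    using F F' by auto
  have dist: "d \<otimes>\<^bsub>S\<^esub> (a \<otimes>\<^bsub>S\<^esub> s' \<ominus>\<^bsub>S\<^esub> b \<otimes>\<^bsub>S\<^esub> s) = a \<otimes>\<^bsub>S\<^esub> (d \<otimes>\<^bsub>S\<^esub> s') \<ominus>\<^bsub>S\<^esub> b \<otimes>\<^bsub>S\<^esub> (d \<otimes>\<^bsub>S\<^esub> s)"
    if "a \<in> carrier S" "b \<in> carrier S" "s \<in> carrier S" "s' \<in> carrier S" "d \<in> carrier S" for a b s s' d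
    using that by algebra
  have dist': "(a \<otimes>\<^bsub>S\<^esub> s' \<ominus>\<^bsub>S\<^esub> b \<otimes>\<^bsub>S\<^esub> s) \<otimes>\<^bsub>S\<^esub> s = a \<otimes>\<^bsub>S\<^esub> (s \<otimes>\<^bsub>S\<^esub> s') \<ominus>\<^bsub>S\<^esub> b \<otimes>\<^bsub>S\<^esub> (s \<otimes>\<^bsub>S\<^esub> s)"
    if "a \<in> carrier S" "b \<in> carrier S" "s \<in> carrier S" "s' \<in> carrier S" for a b s s'
    using that by algebra
  have fact: "a \<otimes>\<^bsub>S\<^esub> (a \<otimes>\<^bsub>S\<^esub> s') \<ominus>\<^bsub>S\<^esub> b \<otimes>\<^bsub>S\<^esub> (a \<otimes>\<^bsub>S\<^esub> s) = a \<otimes>\<^bsub>S\<^esub> (a \<otimes>\<^bsub>S\<^esub> s' \<ominus>\<^bsub>S\<^esub> b \<otimes>\<^bsub>S\<^esub> s)"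
    if "a \<in> carrier S" "b \<in> carrier S" "s \<in> carrier S" "s' \<in> carrier S" for a b s s'
    using that by algebra
  have fin: "a \<otimes>\<^bsub>S\<^esub> \<zero>\<^bsub>S\<^esub> \<ominus>\<^bsub>S\<^esub> b \<otimes>\<^bsub>S\<^esub> (a \<otimes>\<^bsub>S\<^esub> d) = \<ominus>\<^bsub>S\<^esub> (a \<otimes>\<^bsub>S\<^esub> b \<otimes>\<^bsub>S\<^esub> d)"
    if "a \<in> carrier S" "b \<in> carrier S" "d \<in> carrier S" for a b d
    using that by algebra
  have ds': "?d \<otimes>\<^bsub>S\<^esub> ?s' = \<zero>\<^bsub>S\<^esub>" using subgroup_diff_mult_sum[OF F F' sub F'] by simp
  have ds: "?d \<otimes>\<^bsub>S\<^esub> ?s = ?a \<otimes>\<^bsub>S\<^esub> ?d"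
    unfolding subgroup_diff_def dist'[OF c(1-4)] subgroup_sum_mult[OF F F' sub]
      subgroup_sum_mult[OF F F subset_refl] fact[OF c(1-4)] ..
  have "?d \<otimes>\<^bsub>S\<^esub> ?d = ?d \<otimes>\<^bsub>S\<^esub> (?a \<otimes>\<^bsub>S\<^esub> ?s' \<ominus>\<^bsub>S\<^esub> ?b \<otimes>\<^bsub>S\<^esub> ?s)"
    by (simp only: subgroup_diff_def)
  also have "\<dots> = \<ominus>\<^bsub>S\<^esub> (?a \<otimes>\<^bsub>S\<^esub> ?b \<otimes>\<^bsub>S\<^esub> ?d)"
    unfolding dist[OF c] ds ds' fin[OF c(1,2,5)] ..
  finally show ?thesis .
qed

text \<open>
  If the difference \<open>d\<close> lay in all maximal ideals, then \<open>1 + r d\<close> would be a unit for every \<open>r\<close>. For \<open>r\<close> inverse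
  to \<open>c = |F| |F'|\<close> modulo \<open>m\<close>, the relation \<open>d d = - c d\<close> gives \<open>d (1 + r d) = - (c r - 1) d\<close>, so \<open>d\<close> would
  have all its coefficients in \<open>m\<close>. Its coefficients on \<open>F' - F\<close> are \<open>|F|\<close>, however.
\<close>

lemma subgroup_diff_notin_maximalideal:
  assumes m: "maximalideal m A"
    and F: "subgroup F G" "finite F" "[card F] \<cdot>\<^bsub>A\<^esub> \<one>\<^bsub>A\<^esub> \<notin> m"
    and F': "subgroup F' G" "finite F'" "[card F'] \<cdot>\<^bsub>A\<^esub> \<one>\<^bsub>A\<^esub> \<notin> m" and sub: "F \<subset> F'"
  shows "\<exists>N. maximalideal N S \<and> subgroup_diff F F' \<notin> N"
proof -
  note mi = A.maximalideal_ideal[OF m]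
  let ?d = "subgroup_diff F F'"
  let ?a = "[card F] \<cdot>\<^bsub>A\<^esub> \<one>\<^bsub>A\<^esub>" let ?b = "[card F'] \<cdot>\<^bsub>A\<^esub> \<one>\<^bsub>A\<^esub>"
  define c where "c = ?a \<otimes>\<^bsub>A\<^esub> ?b"
  have cc: "c \<in> carrier A" by (simp add: c_def)
  have "c \<notin> m" using A.maximalideal_prod[OF m, of ?a ?b] F(3) F'(3) by (auto simp: c_def)
  then obtain r where r: "r \<in> carrier A" "c \<otimes>\<^bsub>A\<^esub> r \<ominus>\<^bsub>A\<^esub> \<one>\<^bsub>A\<^esub> \<in> m"
    using A.inverse_mod_maximalideal[OF m cc] by blast
  have d: "?d \<in> carrier S" using F F' by auto
  have k: "const r \<in> carrier S" "const c \<in> carrier S" using r cc by auto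
  let ?u = "\<one>\<^bsub>S\<^esub> \<oplus>\<^bsub>S\<^esub> const r \<otimes>\<^bsub>S\<^esub> ?d"
  have u: "?u \<in> carrier S" using k d by simp
  have "?u \<notin> Units S"
  proof
    assume "?u \<in> Units S"
    then obtain v where v: "v \<in> carrier S" "?u \<otimes>\<^bsub>S\<^esub> v = \<one>\<^bsub>S\<^esub>" by (auto simp: Units_def)
    have sq: "?d \<otimes>\<^bsub>S\<^esub> ?d = \<ominus>\<^bsub>S\<^esub> (const c \<otimes>\<^bsub>S\<^esub> ?d)"
      using subgroup_diff_square[OF F(1,2) F'(1,2)] sub const.hom_mult[of ?a ?b]
      unfolding c_def by (simp del: mono_mult_mono)
    let ?e = "c \<otimes>\<^bsub>A\<^esub> r \<ominus>\<^bsub>A\<^esub> \<one>\<^bsub>A\<^esub>"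
    have e: "const ?e = const c \<otimes>\<^bsub>S\<^esub> const r \<ominus>\<^bsub>S\<^esub> \<one>\<^bsub>S\<^esub>"
      using cc r by (intro extensionality) (auto simp: one_eq)
    have ei: "?e \<in> carrier A" using cc r by simp
    have "?d = ?d \<otimes>\<^bsub>S\<^esub> (?u \<otimes>\<^bsub>S\<^esub> v)" using d v by simp
    also have "\<dots> = (?d \<oplus>\<^bsub>S\<^esub> const r \<otimes>\<^bsub>S\<^esub> (?d \<otimes>\<^bsub>S\<^esub> ?d)) \<otimes>\<^bsub>S\<^esub> v"
      using d v(1) k by algebra
    also have "\<dots> = \<ominus>\<^bsub>S\<^esub> ((const c \<otimes>\<^bsub>S\<^esub> const r \<ominus>\<^bsub>S\<^esub> \<one>\<^bsub>S\<^esub>) \<otimes>\<^bsub>S\<^esub> (?d \<otimes>\<^bsub>S\<^esub> v))"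
      unfolding sq using d v(1) k by algebra
    finally have *: "?d = \<ominus>\<^bsub>S\<^esub> (const ?e \<otimes>\<^bsub>S\<^esub> (?d \<otimes>\<^bsub>S\<^esub> v))" unfolding e .
    let ?I = "{f \<in> carrier S. \<forall>x\<in>carrier G. f x \<in> m}"
    note I = S.ideal_closed[OF ideal_extension[OF mi]]
    have "const ?e \<in> ?I" using r(2) ei A.ideal_closed(2)[OF mi] by auto
    moreover have "?d \<otimes>\<^bsub>S\<^esub> v \<in> carrier S" using d v(1) by blast
    ultimately have "\<ominus>\<^bsub>S\<^esub> (const ?e \<otimes>\<^bsub>S\<^esub> (?d \<otimes>\<^bsub>S\<^esub> v)) \<in> ?I" by (intro I(4) I(7))
    then have "?d \<in> ?I" by (rule back_subst[OF _ *[symmetric]])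
    moreover obtain z where z: "z \<in> F'" "z \<notin> F" using sub by blast
    have zc: "z \<in> carrier G" using z F' subgroup.subset by blast
    ultimately have "?d z \<in> m" by blast
    moreover have "?d z = ?a"
      unfolding subgroup_diff_def using z zc F F' by (subst minus_apply) (auto simp: a_minus_def)
    ultimately show False using F(3) by simp
  qed
  then obtain N where N: "maximalideal N S" "?u \<in> N"
    using S.nonunit_in_maximalideal[OF u] by blast
  note NI = S.ideal_closed[OF S.maximalideal_ideal[OF N(1)]]
  have "?d \<notin> N"
  proof
    assume "?d \<in> N"
    then have "?u \<ominus>\<^bsub>S\<^esub> const r \<otimes>\<^bsub>S\<^esub> ?d \<in> N" using NI(5,6) N(2) k by blast
    moreover have "?u \<ominus>\<^bsub>S\<^esub> const r \<otimes>\<^bsub>S\<^esub> ?d = \<one>\<^bsub>S\<^esub>" using d k by algebra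
    ultimately show False using S.one_notin_maximalideal[OF N(1)] by simp
  qed
  then show ?thesis using N by blast
qed

text \<open>
  The set in question is a subgroup, and by Cauchy's theorem the orders of its finite subgroups are not divisible by
  \<open>c\<close>. If it were infinite, it would contain an infinite strictly increasing chain of finite subgroups. The
  differences of successive members have product zero, so a maximal ideal that avoids one of them
  contains all others; thus infinitely many maximal ideals would occur.
\<close>

lemma finite_prime_to_characteristic:
  assumes S: "semilocal_ring S" and m: "maximalideal m A"
  defines "c \<equiv> ring_characteristic (A Quot m)"
  shows "finite {x \<in> carrier G. \<not> c dvd G.ord x}" (is "finite ?H")
proof (rule ccontr)
  assume inf: "infinite ?H"
  note dvd = A.ring_characteristic_Quot_dvd[OF A.maximalideal_ideal[OF m], folded c_def]
  have c: "c = 0 \<or> Factorial_Ring.prime c"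
    using A.ring_characteristic_Quot_maximalideal[OF m] by (simp add: c_def)
  have H: "subgroup ?H G"
  proof (rule G.subgroupI)
    show "?H \<noteq> {}" using inf by force
    show "x \<otimes>\<^bsub>G\<^esub> y \<in> ?H" if "x \<in> ?H" "y \<in> ?H" for x y
    proof -
      have "\<not> c dvd G.ord x * G.ord y" using that c by (auto simp: prime_dvd_mult_iff)
      then show ?thesis using that G.abelian_ord_mul_divides[of x y] dvd_trans by blast
    qed
  qed auto
  let ?P = "\<lambda>F. subgroup F G \<and> finite F \<and> F \<subseteq> ?H"
  \<comment> \<open>The case \<open>c = 0\<close> means that \<open>card F\<close> is not zero, the other case is Cauchy's theorem.\<close>
  have card: "[card F] \<cdot>\<^bsub>A\<^esub> \<one>\<^bsub>A\<^esub> \<notin> m" if F: "?P F" for F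
  proof -
    have "card F \<noteq> 0" using F subgroup.one_closed[of F G] by auto
    moreover have "\<not> c dvd card F" if prime: "Factorial_Ring.prime c"
    proof
      assume "c dvd card F"
      then obtain x where "x \<in> F" "G.ord x = c" using G.finite_subgroup_cauchy[of F c] F prime by blast
      then show False using F by auto
    qed
    ultimately have "\<not> c dvd card F" using c by auto
    then show ?thesis using dvd by blast
  qed
  have "\<exists>f. \<forall>n. ?P (f n) \<and> f n \<subset> f (Suc n)"
  proof (rule dependent_nat_choice)
    show "\<exists>F. ?P F"
    proof (intro exI conjI)
      show "subgroup {\<one>\<^bsub>G\<^esub>} G" by (rule G.triv_subgroup)
      show "{\<one>\<^bsub>G\<^esub>} \<subseteq> ?H" using subgroup.one_closed[OF H] by blast
    qed simp
    fix F and n :: nat assume F: "?P F"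
    then have "\<not> ?H \<subseteq> F" using inf finite_subset[of ?H F] by auto
    then obtain x where x: "x \<in> ?H" "x \<notin> F" by blast
    then have "x \<in> carrier G" by blast
    moreover have "G.ord x \<noteq> 0" using x(1) dvd_0_right[of c] by (metis (mono_tags, lifting) mem_Collect_eq)
    ultimately obtain F' where F': "subgroup F' G" "finite F'" "F \<subseteq> F'" "x \<in> F'"
      "\<forall>K. subgroup K G \<longrightarrow> F \<subseteq> K \<longrightarrow> x \<in> K \<longrightarrow> F' \<subseteq> K"
      using G.finite_subgroup_adjoin[of F x] F by metis
    then have "F' \<subseteq> ?H" using H F x(1) by blast
    then show "\<exists>F'. ?P F' \<and> F \<subset> F'" using F' x(2) by blast
  qed
  then obtain f where f': "\<forall>n::nat. ?P (f n) \<and> f n \<subset> f (Suc n)" by (rule exE)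
  have f: "?P (f n)" "f n \<subset> f (Suc n)" for n using spec[OF f', of n] by simp_all
  let ?d = "\<lambda>n. subgroup_diff (f n) (f (Suc n))"
  have "\<exists>N. maximalideal N S \<and> ?d n \<notin> N" for n
    using subgroup_diff_notin_maximalideal[OF m, of "f n" "f (Suc n)"] f(1)[of n] f(1)[of "Suc n"]
      f(2)[of n] card[of "f n"] card[of "f (Suc n)"] by simp
  then obtain N where N: "\<And>n. maximalideal (N n) S" "\<And>n. ?d n \<notin> N n" by metis
  have chain: "f i \<subseteq> f j" if "i \<le> j" for i j
    by (rule lift_Suc_mono_le[OF _ that]) (use f(2) in blast)
  have ne: "N i \<noteq> N j" if ij: "i < j" for i j
  proof
    assume eq: "N i = N j"
    have "?d i \<otimes>\<^bsub>S\<^esub> ?d j = \<zero>\<^bsub>S\<^esub>"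
      using subgroup_diff_orthogonal[of "f i" "f (Suc i)" "f j" "f (Suc j)"] f(1)
        chain[of i "Suc i"] chain[of "Suc i" j] chain[of j "Suc j"] ij by auto
    then have "?d i \<otimes>\<^bsub>S\<^esub> ?d j \<in> N j"
      using S.ideal_closed(2)[OF S.maximalideal_ideal[OF N(1)]] by simp
    moreover have "?d i \<in> carrier S" "?d j \<in> carrier S" using f(1) by auto
    ultimately show False
      using S.maximalideal_prod[OF N(1)[of j], of "?d i" "?d j"] N(2)[of i] N(2)[of j] eq by auto
  qed
  have "inj N" using ne by (metis injI linorder_neqE_nat)
  moreover have "range N \<subseteq> {M. maximalideal M S}" using N(1) by blast
  then have "finite (range N)" using S finite_subset by (auto simp: semilocal_ring_def)
  ultimately show False using range_inj_infinite by blast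
qed

lemma semilocal_imp_p_group_by_finite:
  assumes S: "semilocal_ring S" and inf: "infinite (carrier G)"
  shows "\<exists>p::nat. Factorial_Ring.prime p \<and> ring_characteristic (A Quot jacobson_radical A) = p \<and>
    (\<exists>G\<^sub>p G\<^sub>0. internal_direct_product G G\<^sub>p G\<^sub>0 \<and> infinite G\<^sub>p \<and> p_group p (G\<lparr>carrier := G\<^sub>p\<rparr>) \<and>
      finite G\<^sub>0 \<and> \<not> p dvd card G\<^sub>0)"
proof -
  note tors = semilocal_imp_torsion[OF S]
  let ?c = "\<lambda>m. ring_characteristic (A Quot m)"
  let ?H = "\<lambda>c. {x \<in> carrier G. \<not> c dvd G.ord x}"
  have prime_c: "Factorial_Ring.prime (?c m)" if m: "maximalideal m A" for m
  proof -
    have "?c m \<noteq> 0"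
    proof
      assume "?c m = 0"
      then have "?H (?c m) = carrier G" using tors by auto
      then show False using finite_prime_to_characteristic[OF S m] inf by simp
    qed
    then show ?thesis using A.ring_characteristic_Quot_maximalideal[OF m] by simp
  qed
  have "ideal {\<zero>\<^bsub>A\<^esub>} A" by (rule A.zeroideal)
  then obtain m where m: "maximalideal m A"
    using A.ideal_subset_maximalideal[of "{\<zero>\<^bsub>A\<^esub>}"] one_not_zero by auto
  define p where "p = ?c m"
  have p: "Factorial_Ring.prime p" using prime_c[OF m] by (simp add: p_def)
  have fin: "finite (?H p)" using finite_prime_to_characteristic[OF S m] by (simp add: p_def)
  \<comment> \<open>A \<open>p\<close>-power is prime to a prime \<open>q \<noteq> p\<close>, so both primary components of an element of \<open>G\<close> would
    range over finite sets.\<close>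
  have same: "?c m' = p" if m': "maximalideal m' A" for m'
  proof (rule ccontr)
    assume ne: "?c m' \<noteq> p"
    let ?q = "?c m'"
    have q: "Factorial_Ring.prime ?q" using prime_c[OF m'] .
    have "carrier G \<subseteq> (\<lambda>(y, z). y \<otimes>\<^bsub>G\<^esub> z) ` (?H ?q \<times> ?H p)"
    proof
      fix x assume x: "x \<in> carrier G"
      obtain y z k where yz: "y \<in> carrier G" "z \<in> carrier G" "x = y \<otimes>\<^bsub>G\<^esub> z" "G.ord y = p ^ k"
        "\<not> p dvd G.ord z"
        using G.primary_decomposition[OF x tors[OF x] p] by blast
      have "\<not> ?q dvd p ^ k" using q p ne by (metis prime_dvd_power primes_dvd_imp_eq)
      then have "(y, z) \<in> ?H ?q \<times> ?H p" using yz by simp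
      then show "x \<in> (\<lambda>(y, z). y \<otimes>\<^bsub>G\<^esub> z) ` (?H ?q \<times> ?H p)" using yz(3) by force
    qed
    moreover have "finite (?H ?q \<times> ?H p)" using fin finite_prime_to_characteristic[OF S m'] by simp
    ultimately show False using inf finite_surj[of "?H ?q \<times> ?H p" "carrier G"] by blast
  qed
  have radical: "[n] \<cdot>\<^bsub>A\<^esub> \<one>\<^bsub>A\<^esub> \<in> jacobson_radical A \<longleftrightarrow> p dvd n" for n
  proof -
    have "[n] \<cdot>\<^bsub>A\<^esub> \<one>\<^bsub>A\<^esub> \<in> m' \<longleftrightarrow> p dvd n" if "maximalideal m' A" for m'
      using A.ring_characteristic_Quot_dvd[OF A.maximalideal_ideal[OF that]] same[OF that] by simp
    then show ?thesis using m unfolding jacobson_radical_def by auto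
  qed
  have char: "ring_characteristic (A Quot jacobson_radical A) = p"
    using A.ring_characteristic_Quot_dvd[OF A.ideal_jacobson_radical] radical by (metis dvd_antisym dvd_refl)
  let ?Gp = "{x \<in> carrier G. \<exists>k. G.ord x = p ^ k}"
  have sp: "subgroup ?Gp G"
  proof (rule G.subgroupI)
    have "G.ord \<one>\<^bsub>G\<^esub> = p ^ 0" by simp
    then show "?Gp \<noteq> {}" using G.one_closed by blast
    show "x \<otimes>\<^bsub>G\<^esub> y \<in> ?Gp" if xy: "x \<in> ?Gp" "y \<in> ?Gp" for x y
    proof -
      obtain k l where "G.ord x = p ^ k" "G.ord y = p ^ l" using xy by blast
      then have "G.ord (x \<otimes>\<^bsub>G\<^esub> y) dvd p ^ (k + l)"
        using G.abelian_ord_mul_divides[of x y] xy by (simp add: power_add)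
      then show ?thesis using divides_primepow_nat[OF p] xy by blast
    qed
  qed auto
  have s0: "subgroup (?H p) G"
  proof (rule G.subgroupI)
    have "\<not> p dvd G.ord \<one>\<^bsub>G\<^esub>" using p by auto
    then show "?H p \<noteq> {}" using G.one_closed by blast
    show "x \<otimes>\<^bsub>G\<^esub> y \<in> ?H p" if xy: "x \<in> ?H p" "y \<in> ?H p" for x y
    proof -
      have "\<not> p dvd G.ord x * G.ord y" using xy p by (simp add: prime_dvd_mult_iff)
      then show ?thesis using xy G.abelian_ord_mul_divides[of x y] dvd_trans by blast
    qed
  qed auto
  have inter: "?Gp \<inter> ?H p = {\<one>\<^bsub>G\<^esub>}"
  proof
    show "?Gp \<inter> ?H p \<subseteq> {\<one>\<^bsub>G\<^esub>}"
    proof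
      fix x assume x: "x \<in> ?Gp \<inter> ?H p"
      then obtain k where k: "G.ord x = p ^ k" "\<not> p dvd p ^ k" by auto
      then have "G.ord x = 1" by (cases k) auto
      then show "x \<in> {\<one>\<^bsub>G\<^esub>}" using x G.ord_eq_1 by blast
    qed
    show "{\<one>\<^bsub>G\<^esub>} \<subseteq> ?Gp \<inter> ?H p"
      using subgroup.one_closed[OF sp] subgroup.one_closed[OF s0] by blast
  qed
  have prod: "?Gp <#>\<^bsub>G\<^esub> ?H p = carrier G"
  proof
    show "?Gp <#>\<^bsub>G\<^esub> ?H p \<subseteq> carrier G" by (auto simp: set_mult_def)
    show "carrier G \<subseteq> ?Gp <#>\<^bsub>G\<^esub> ?H p"
      using G.primary_decomposition[OF _ tors p] unfolding set_mult_def by blast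
  qed
  have "internal_direct_product G ?Gp (?H p)"
    using sp s0 inter prod G.subgroup_imp_normal by (simp add: internal_direct_product_def)
  moreover have "infinite ?Gp"
  proof
    assume "finite ?Gp"
    then have "finite ((\<lambda>(y, z). y \<otimes>\<^bsub>G\<^esub> z) ` (?Gp \<times> ?H p))" using fin by blast
    moreover have "?Gp <#>\<^bsub>G\<^esub> ?H p = (\<lambda>(y, z). y \<otimes>\<^bsub>G\<^esub> z) ` (?Gp \<times> ?H p)" by (auto simp: set_mult_def)
    ultimately show False using prod inf by simp
  qed
  moreover have "p_group p (G\<lparr>carrier := ?Gp\<rparr>)"
    unfolding p_group_def using G.subgroup_imp_group[OF sp] G.ord_in_subgroup[OF sp] by auto
  moreover have "\<not> p dvd card (?H p)"
    using G.finite_subgroup_cauchy[OF s0 fin p] by auto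
  ultimately show ?thesis using p char fin by blast
qed

end

section \<open>The characterization\<close>

theorem proposition2:
  fixes A :: "('a, 'm) ring_scheme" and G :: "('g, 'n) monoid_scheme"
  assumes "cring A" and "\<one>\<^bsub>A\<^esub> \<noteq> \<zero>\<^bsub>A\<^esub>" and "comm_group G"
  shows "semilocal_ring (group_ring A G) \<longleftrightarrow>
    semilocal_ring A \<and>
    (finite (carrier G) \<or>
     infinite (carrier G) \<and>
     (\<exists>p::nat. Factorial_Ring.prime p \<and>
        ring_characteristic (A Quot jacobson_radical A) = p \<and>
        (\<exists>G\<^sub>p G\<^sub>0. internal_direct_product G G\<^sub>p G\<^sub>0 \<and>
           infinite G\<^sub>p \<and> p_group p (G\<lparr>carrier := G\<^sub>p\<rparr>) \<and>
           finite G\<^sub>0 \<and> \<not> p dvd card G\<^sub>0)))"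
proof -
  interpret comm_group_ring A G
    using assms by (intro comm_group_ring.intro comm_group_ring_axioms.intro)
  show ?thesis
    using semilocal_coefficients semilocal_imp_p_group_by_finite semilocal_if_finite
      semilocal_if_p_group_by_finite by blast
qed

end
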